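(* Let $c\geq 0$ be an integer and let $G$ be a JNN$_c$F profinite or discrete group that has no non-trivial abelian normal subgroup. Then $G$ is hereditarily JNN$_c$F if and only if every maximal subgroup of $G$ of finite index is JNN$_c$F.
   Context: Convention: for a profinite group, "subgroup" means closed subgroup (so a subgroup of finite index is open); for a discrete group there is no topological restriction. The lower central series is $\gamma_1(H)=H$, $\gamma_{i+1}(H)=[\gamma_i(H),H]$ (with closed commutator subgroups in the profinite case). A group is virtually class-$c$ nilpotent if it has a subgroup $H$ of finite index with $\gamma_{c+1}(H)=1$. A profinite (or discrete) group $G$ is JNN$_c$F if $G$ is not virtually class-$c$ nilpotent but $G/N$ is virtually class-$c$ nilpotent for every non-trivial (closed) normal subgroup $N$ of $G$. It is hereditarily JNN$_c$F if every (closed) subgroup of finite index in $G$ is JNN$_c$F. *)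

theory Defs
  imports
    "HOL-Analysis.Abstract_Topological_Spaces"
    "HOL-Algebra.Coset"
    "HOL-Algebra.Generated_Groups"
begin

locale topological_group = group G for G (structure) +
  fixes T :: "'a topology"
  assumes topspace_eq: "topspace T = carrier G"
    and continuous_mult: "continuous_map (prod_topology T T) T (\<lambda>(x, y). x \<otimes> y)"
    and continuous_inv: "continuous_map T T (\<lambda>x. inv x)"

locale profinite_group = topological_group +
  assumes compact: "compact_space T"
    and Hausdorff: "Hausdorff_space T"
    and totally_disconnected: "\<lbrakk>connectedin T S; x \<in> S; y \<in> S\<rbrakk> \<Longrightarrow> x = y"

locale discrete_group = group G for G (structure) +
  fixes T :: "'a topology"
  assumes discrete: "T = discrete_topology (carrier G)"

text \<open>
  All notions below are stated for a pair of a group and a topology on its carrier. In the discrete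
  case, closedness conditions are vacuous and closures are trivial, so profinite and
  abstract groups are covered uniformly.
\<close>

definition closed_subgroup :: "('a, 'b) monoid_scheme \<Rightarrow> 'a topology \<Rightarrow> 'a set \<Rightarrow> bool" where
  "closed_subgroup G T H \<longleftrightarrow> subgroup H G \<and> closedin T H"

definition closed_normal :: "('a, 'b) monoid_scheme \<Rightarrow> 'a topology \<Rightarrow> 'a set \<Rightarrow> bool" where
  "closed_normal G T N \<longleftrightarrow> N \<lhd> G \<and> closedin T N"

definition finite_index :: "('a, 'b) monoid_scheme \<Rightarrow> 'a set \<Rightarrow> bool" where
  "finite_index G H \<longleftrightarrow> finite (rcosets\<^bsub>G\<^esub> H)"

definition closed_commutator ::
    "('a, 'b) monoid_scheme \<Rightarrow> 'a topology \<Rightarrow> 'a set \<Rightarrow> 'a set \<Rightarrow> 'a set" where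
  "closed_commutator G T A B = T closure_of
     generate G {a \<otimes>\<^bsub>G\<^esub> b \<otimes>\<^bsub>G\<^esub> inv\<^bsub>G\<^esub> a \<otimes>\<^bsub>G\<^esub> inv\<^bsub>G\<^esub> b | a b. a \<in> A \<and> b \<in> B}"

text \<open>The indexing starts at 0: \<open>lower_central G T H i\<close> is the term $\gamma_{i+1}(H)$.\<close>

primrec lower_central ::
    "('a, 'b) monoid_scheme \<Rightarrow> 'a topology \<Rightarrow> 'a set \<Rightarrow> nat \<Rightarrow> 'a set" where
  "lower_central G T H 0 = H"
| "lower_central G T H (Suc i) = closed_commutator G T (lower_central G T H i) H"

definition virtually_nilpotent :: "nat \<Rightarrow> ('a, 'b) monoid_scheme \<Rightarrow> 'a topology \<Rightarrow> bool" where
  "virtually_nilpotent c G T \<longleftrightarrow>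
     (\<exists>H. closed_subgroup G T H \<and> finite_index G H \<and> lower_central G T H c = {\<one>\<^bsub>G\<^esub>})"

definition quotient_group_topology ::
    "('a, 'b) monoid_scheme \<Rightarrow> 'a topology \<Rightarrow> 'a set \<Rightarrow> 'a set topology" where
  "quotient_group_topology G T N = topology (\<lambda>U. U \<subseteq> carrier (G Mod N) \<and>
     openin T {g \<in> carrier G. N #>\<^bsub>G\<^esub> g \<in> U})"

lemma openin_quotient_group_topology:
  "openin (quotient_group_topology G T N) U \<longleftrightarrow>
     U \<subseteq> carrier (G Mod N) \<and> openin T {g \<in> carrier G. N #>\<^bsub>G\<^esub> g \<in> U}"
proof -
  have "istopology (\<lambda>U. U \<subseteq> carrier (G Mod N) \<and> openin T {g \<in> carrier G. N #>\<^bsub>G\<^esub> g \<in> U})"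
    unfolding istopology_def
  proof (intro conjI allI impI; (elim conjE)?)
    fix U V
    assume "openin T {g \<in> carrier G. N #>\<^bsub>G\<^esub> g \<in> U}" "openin T {g \<in> carrier G. N #>\<^bsub>G\<^esub> g \<in> V}"
    then have "openin T ({g \<in> carrier G. N #>\<^bsub>G\<^esub> g \<in> U} \<inter> {g \<in> carrier G. N #>\<^bsub>G\<^esub> g \<in> V})"
      by (rule openin_Int)
    also have "{g \<in> carrier G. N #>\<^bsub>G\<^esub> g \<in> U} \<inter> {g \<in> carrier G. N #>\<^bsub>G\<^esub> g \<in> V}
        = {g \<in> carrier G. N #>\<^bsub>G\<^esub> g \<in> U \<inter> V}"
      by blast
    finally show "openin T {g \<in> carrier G. N #>\<^bsub>G\<^esub> g \<in> U \<inter> V}" .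
  next
    fix \<K>
    assume "\<forall>K\<in>\<K>. K \<subseteq> carrier (G Mod N) \<and> openin T {g \<in> carrier G. N #>\<^bsub>G\<^esub> g \<in> K}"
    then have "openin T (\<Union>K\<in>\<K>. {g \<in> carrier G. N #>\<^bsub>G\<^esub> g \<in> K})"
      by blast
    also have "(\<Union>K\<in>\<K>. {g \<in> carrier G. N #>\<^bsub>G\<^esub> g \<in> K}) = {g \<in> carrier G. N #>\<^bsub>G\<^esub> g \<in> \<Union>\<K>}"
      by blast
    finally show "openin T {g \<in> carrier G. N #>\<^bsub>G\<^esub> g \<in> \<Union>\<K>}" .
  qed auto
  then show ?thesis
    by (simp add: quotient_group_topology_def)
qed

lemma topspace_quotient_group_topology:
  assumes "topspace T = carrier G"
  shows "topspace (quotient_group_topology G T N) = carrier (G Mod N)"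
proof (rule antisym)
  show "topspace (quotient_group_topology G T N) \<subseteq> carrier (G Mod N)"
    using openin_quotient_group_topology openin_topspace by blast
  have "{g \<in> carrier G. N #>\<^bsub>G\<^esub> g \<in> carrier (G Mod N)} = topspace T"
    using assms by (auto simp: carrier_FactGroup)
  then have "openin (quotient_group_topology G T N) (carrier (G Mod N))"
    by (simp add: openin_quotient_group_topology)
  then show "carrier (G Mod N) \<subseteq> topspace (quotient_group_topology G T N)"
    by (rule openin_subset)
qed

lemma quotient_map_quotient_group_topology:
  assumes "topspace T = carrier G"
  shows "quotient_map T (quotient_group_topology G T N) (\<lambda>g. N #>\<^bsub>G\<^esub> g)"
  using assms
  by (simp add: quotient_map_def topspace_quotient_group_topology
      openin_quotient_group_topology carrier_FactGroup)

definition JNNF :: "nat \<Rightarrow> ('a, 'b) monoid_scheme \<Rightarrow> 'a topology \<Rightarrow> bool" where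
  "JNNF c G T \<longleftrightarrow> \<not> virtually_nilpotent c G T \<and>
     (\<forall>N. closed_normal G T N \<and> N \<noteq> {\<one>\<^bsub>G\<^esub>} \<longrightarrow>
        virtually_nilpotent c (G Mod N) (quotient_group_topology G T N))"

definition hereditarily_JNNF :: "nat \<Rightarrow> ('a, 'b) monoid_scheme \<Rightarrow> 'a topology \<Rightarrow> bool" where
  "hereditarily_JNNF c G T \<longleftrightarrow>
     (\<forall>H. closed_subgroup G T H \<and> finite_index G H \<longrightarrow>
        JNNF c (G\<lparr>carrier := H\<rparr>) (subtopology T H))"

definition maximal_subgroup :: "('a, 'b) monoid_scheme \<Rightarrow> 'a topology \<Rightarrow> 'a set \<Rightarrow> bool" where
  "maximal_subgroup G T M \<longleftrightarrow> closed_subgroup G T M \<and> M \<noteq> carrier G \<and>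
     (\<forall>K. closed_subgroup G T K \<and> M \<subseteq> K \<longrightarrow> K = M \<or> K = carrier G)"

end

theory Submission
  imports Defs
begin

text \<open>
  The interesting direction: let \<open>H\<close> be closed of finite index with normal core \<open>U\<close>, and let \<open>K\<close> be a
  non-trivial closed normal subgroup of \<open>H\<close>. A non-trivial normal subgroup of \<open>G\<close> has trivial
  centralizer: its closure \<open>N\<close> and its centralizer \<open>C\<close> have abelian, hence trivial, intersection, so if
  \<open>C\<close> were non-trivial then \<open>G\<close> would embed into \<open>G/N \<times> G/C\<close> and be virtually nilpotent. Hence
  \<open>K \<inter> U\<close> is non-trivial. It has finitely many conjugates, and intersecting a maximal family of
  them with non-trivial intersection yields a basal subgroup \<open>B\<close> of \<open>K \<inter> U\<close>: any two conjugates
  of \<open>B\<close> coincide or meet trivially, and in the latter case commute.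

  If \<open>B\<close> is normal in \<open>G\<close>, then \<open>G/B\<close> is virtually nilpotent and so is \<open>H/K\<close>. Otherwise the normalizer
  of \<open>B\<close> lies in a maximal subgroup \<open>M\<close> of finite index. For \<open>g \<notin> M\<close> the conjugate \<open>D\<close> of \<open>B\<close> by
  \<open>g\<close> commutes with the closed normal closure \<open>P\<close> of \<open>B\<close> in \<open>M\<close>. As \<open>M/P\<close> is virtually nilpotent,
  \<open>D\<close> has a nilpotent subgroup of finite index, which is non-trivial and may be taken normalized by
  \<open>U\<close>. Its last non-trivial lower central term is abelian, and the basal construction applied to that
  term gives a non-trivial abelian normal subgroup of \<open>G\<close>, a contradiction.

  The topology is eliminated at the start. Closures preserve nilpotency in a Hausdorff group, so virtual
  nilpotency of \<open>G/N\<close> with \<open>N\<close> closed says that some subgroup of finite index, closed or not, has its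
  abstract lower central term \<open>c\<close> (indexed from 0) contained in \<open>N\<close>.
\<close>

section \<open>Finite index and abstract lower central series\<close>

text \<open>The indexing matches \<open>lower_central\<close>, so \<open>lcs G H c\<close> is
  gamma_{c+1}(H) without closures.\<close>

primrec lcs :: "('a, 'b) monoid_scheme \<Rightarrow> 'a set \<Rightarrow> nat \<Rightarrow> 'a set" where
  "lcs G H 0 = H"
| "lcs G H (Suc i) = generate G
     {a \<otimes>\<^bsub>G\<^esub> b \<otimes>\<^bsub>G\<^esub> inv\<^bsub>G\<^esub> a \<otimes>\<^bsub>G\<^esub> inv\<^bsub>G\<^esub> b | a b. a \<in> lcs G H i \<and> b \<in> H}"

text \<open>For a normal subgroup \<open>N\<close> this expresses virtual class-\<open>c\<close>
  nilpotency of \<open>G/N\<close> inside \<open>G\<close> itself. It is monotone in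
  \<open>N\<close>, which later passes the property from a small subgroup to a larger one.\<close>

definition virt_nilpotent_mod :: "nat \<Rightarrow> ('a, 'b) monoid_scheme \<Rightarrow> 'a set \<Rightarrow> bool" where
  "virt_nilpotent_mod c G N \<longleftrightarrow> (\<exists>L. subgroup L G \<and> finite_index G L \<and> lcs G L c \<subseteq> N)"

definition conj_set :: "('a, 'b) monoid_scheme \<Rightarrow> 'a \<Rightarrow> 'a set \<Rightarrow> 'a set" where
  "conj_set G g A = (\<lambda>x. g \<otimes>\<^bsub>G\<^esub> x \<otimes>\<^bsub>G\<^esub> inv\<^bsub>G\<^esub> g) ` A"

definition centralizer :: "('a, 'b) monoid_scheme \<Rightarrow> 'a set \<Rightarrow> 'a set" where
  "centralizer G S = {x \<in> carrier G. \<forall>s\<in>S. x \<otimes>\<^bsub>G\<^esub> s = s \<otimes>\<^bsub>G\<^esub> x}"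

definition set_normalizer :: "('a, 'b) monoid_scheme \<Rightarrow> 'a set \<Rightarrow> 'a set" where
  "set_normalizer G B = {g \<in> carrier G. conj_set G g B = B}"

definition normal_core :: "('a, 'b) monoid_scheme \<Rightarrow> 'a set \<Rightarrow> 'a set" where
  "normal_core G H = {x \<in> carrier G. \<forall>g\<in>carrier G. g \<otimes>\<^bsub>G\<^esub> x \<otimes>\<^bsub>G\<^esub> inv\<^bsub>G\<^esub> g \<in> H}"

text \<open>Inclusion is asked here because it is easier to establish; when \<open>U\<close> is a
  subgroup, \<open>conj_set_eq_self\<close> recovers equality. In \<open>set_normalizer\<close>
  equality is built in, so that the result is closed under inverses.\<close>

definition normalizes :: "('a, 'b) monoid_scheme \<Rightarrow> 'a set \<Rightarrow> 'a set \<Rightarrow> bool" where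
  "normalizes G U A \<longleftrightarrow> (\<forall>u\<in>U. \<forall>a\<in>A. u \<otimes>\<^bsub>G\<^esub> a \<otimes>\<^bsub>G\<^esub> inv\<^bsub>G\<^esub> u \<in> A)"

text \<open>On \<open>A\<close> the map \<open>h\<close> factors through \<open>f\<close>: choose
  one point in each fibre of \<open>f\<close>.\<close>

lemma finite_image_factor:
  assumes "finite (f ` A)" and eq: "\<And>x y. \<lbrakk>x \<in> A; y \<in> A; f x = f y\<rbrakk> \<Longrightarrow> h x = h y"
  shows "finite (h ` A)"
proof -
  have "h x = h (inv_into A f (f x))" if "x \<in> A" for x
    using eq[of x "inv_into A f (f x)"] that by (simp add: inv_into_into f_inv_into_f)
  then have "h ` A \<subseteq> (\<lambda>v. h (inv_into A f v)) ` (f ` A)" by auto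
  then show ?thesis using assms(1) by (meson finite_imageI finite_subset)
qed

context group
begin

lemma inv_mult_cancel:
  assumes "x \<in> carrier G" "y \<in> carrier G"
  shows "inv x \<otimes> (x \<otimes> y) = y" "x \<otimes> (inv x \<otimes> y) = y"
  using assms by (simp_all flip: m_assoc)

lemma commutators_in_carrier:
  assumes "A \<subseteq> carrier G" "B \<subseteq> carrier G"
  shows "{a \<otimes> b \<otimes> inv a \<otimes> inv b | a b. a \<in> A \<and> b \<in> B} \<subseteq> carrier G"
  using assms by (blast intro: m_closed inv_closed)

lemma lcs_in_carrier:
  assumes "H \<subseteq> carrier G"
  shows "lcs G H i \<subseteq> carrier G"
proof (induction i)
  case (Suc i)
  then show ?case
    using generate_incl[OF commutators_in_carrier[OF Suc assms]] by simp
qed (use assms in simp)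

lemma lcs_subgroup:
  assumes "subgroup H G"
  shows "subgroup (lcs G H i) G"
proof (cases i)
  case (Suc j)
  then show ?thesis
    using generate_is_subgroup[OF commutators_in_carrier[of "lcs G H j" H]]
      subgroup.subset[OF assms] lcs_in_carrier[of H j] by simp
qed (use assms in simp)

lemma lcs_mono:
  assumes "A \<subseteq> B"
  shows "lcs G A i \<subseteq> lcs G B i"
proof (induction i)
  case (Suc i)
  then show ?case
    unfolding lcs.simps using assms by (intro mono_generate) blast
qed (use assms in simp)

lemma lcs_subset:
  assumes "subgroup H G"
  shows "lcs G H i \<subseteq> H"
proof (induction i)
  case (Suc i)
  have "{a \<otimes> b \<otimes> inv a \<otimes> inv b | a b. a \<in> lcs G H i \<and> b \<in> H} \<subseteq> H"
    using Suc subgroup.m_closed[OF assms] subgroup.m_inv_closed[OF assms] by blast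
  then show ?case
    using assms by (simp add: generate_subgroup_incl)
qed simp

lemma commutator_one_iff:
  assumes "x \<in> carrier G" "y \<in> carrier G"
  shows "x \<otimes> y \<otimes> inv x \<otimes> inv y = \<one> \<longleftrightarrow> x \<otimes> y = y \<otimes> x"
proof -
  have "x \<otimes> y \<otimes> inv x \<otimes> inv y = \<one> \<longleftrightarrow> x \<otimes> y \<otimes> inv x = y"
    using assms inv_equality[of "x \<otimes> y \<otimes> inv x" "inv y"] by (metis inv_closed inv_inv m_closed r_inv)
  also have "\<dots> \<longleftrightarrow> x \<otimes> y = y \<otimes> x"
    using assms inv_solve_right by (metis m_closed)
  finally show ?thesis .
qed

text \<open>The map sending \<open>x\<close> to \<open>H #> x\<close> factors through
  \<open>f\<close>. The finite index statements of this section are proved by exhibiting such a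
  finite-valued invariant.\<close>

lemma finite_indexI:
  assumes "subgroup H G" and "finite (f ` carrier G)"
    and eq: "\<And>x y. \<lbrakk>x \<in> carrier G; y \<in> carrier G; f x = f y\<rbrakk> \<Longrightarrow> x \<otimes> inv y \<in> H"
  shows "finite_index G H"
proof -
  have "H #> x = H #> y" if xy: "x \<in> carrier G" "y \<in> carrier G" "f x = f y" for x y
  proof -
    have "x \<in> H #> y"
      using eq[OF xy] xy subgroup.rcos_module[OF assms(1) group_axioms, of y x] by simp
    then have "H #> y = H #> x"
      using xy(2) assms(1) by (rule repr_independence)
    then show ?thesis by (rule sym)
  qed
  then have "finite ((\<lambda>x. H #> x) ` carrier G)"
    by (rule finite_image_factor[OF assms(2)])
  moreover have "rcosets H = (\<lambda>x. H #> x) ` carrier G"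
    by (auto simp: RCOSETS_def)
  ultimately show ?thesis by (simp add: finite_index_def)
qed

lemma r_coset_eqD:
  assumes "subgroup H G" "x \<in> carrier G" "y \<in> carrier G" "H #> x = H #> y"
  shows "x \<otimes> inv y \<in> H"
proof -
  have "x \<in> H #> y"
    using assms rcos_self by metis
  then show ?thesis
    using assms subgroup.rcos_module[OF assms(1) group_axioms, of y x] by simp
qed

lemma finite_index_image_r_coset:
  assumes "finite_index G H"
  shows "finite ((\<lambda>x. H #> x) ` carrier G)"
proof -
  have "(\<lambda>x. H #> x) ` carrier G = rcosets H"
    by (auto simp: RCOSETS_def)
  then show ?thesis
    using assms by (simp add: finite_index_def)
qed

lemma finite_index_mono:
  assumes "subgroup H G" "subgroup K G" "H \<subseteq> K" "finite_index G H"
  shows "finite_index G K"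
proof (rule finite_indexI[where f = "\<lambda>x. H #> x"])
  show "x \<otimes> inv y \<in> K" if "x \<in> carrier G" "y \<in> carrier G" "H #> x = H #> y" for x y
    using r_coset_eqD[OF assms(1) that] assms(3) by blast
qed (fact assms(2) finite_index_image_r_coset[OF assms(4)])+

lemma finite_index_Int:
  assumes "subgroup H G" "subgroup K G" "finite_index G H" "finite_index G K"
  shows "finite_index G (H \<inter> K)"
proof (rule finite_indexI[where f = "\<lambda>x. (H #> x, K #> x)"])
  show "subgroup (H \<inter> K) G"
    using assms subgroups_Inter_pair by blast
  have "(\<lambda>x. (H #> x, K #> x)) ` carrier G \<subseteq>
      ((\<lambda>x. H #> x) ` carrier G) \<times> ((\<lambda>x. K #> x) ` carrier G)"
    by auto
  then show "finite ((\<lambda>x. (H #> x, K #> x)) ` carrier G)"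
    by (rule finite_subset) (intro finite_cartesian_product finite_index_image_r_coset assms)
next
  show "x \<otimes> inv y \<in> H \<inter> K" if "x \<in> carrier G" "y \<in> carrier G" "(H #> x, K #> x) = (H #> y, K #> y)"
    for x y
    using r_coset_eqD[OF assms(1) that(1,2)] r_coset_eqD[OF assms(2) that(1,2)] that(3) by simp
qed

lemma finite_index_trans:
  assumes H: "subgroup H G" and L: "subgroup L G" "L \<subseteq> H"
    and fin: "finite_index G H" "finite_index (G\<lparr>carrier := H\<rparr>) L"
  shows "finite_index G L"
proof -
  \<comment> \<open>A representative chosen in each right coset of \<open>H\<close>; dividing by it
    moves \<open>x\<close> into \<open>H\<close>, where cosets of \<open>L\<close> can be
    counted.\<close>
  define r where "r C = (SOME x. x \<in> carrier G \<and> H #> x = C)" for C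
  have r: "r (H #> x) \<in> carrier G \<and> H #> r (H #> x) = H #> x" if "x \<in> carrier G" for x
    unfolding r_def by (rule someI[of _ x]) (use that in simp)
  have rH: "x \<otimes> inv (r (H #> x)) \<in> H" if "x \<in> carrier G" for x
    using r_coset_eqD[OF H that, of "r (H #> x)"] r[OF that] by simp
  have eq: "rcosets\<^bsub>G\<lparr>carrier := H\<rparr>\<^esub> L = (\<lambda>x. L #> x) ` H"
    by (auto simp: RCOSETS_def r_coset_def)
  show ?thesis
  \<comment> \<open>The invariant is the \<open>H\<close>-coset of \<open>x\<close> together with
    the \<open>L\<close>-coset of its part in \<open>H\<close>. When both agree for \<open>x\<close>
    and \<open>y\<close>, the common representative cancels.\<close>
  proof (rule finite_indexI[where f = "\<lambda>x. (H #> x, L #> (x \<otimes> inv (r (H #> x))))"])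
    have "(\<lambda>x. (H #> x, L #> (x \<otimes> inv (r (H #> x))))) ` carrier G
        \<subseteq> ((\<lambda>x. H #> x) ` carrier G) \<times> ((\<lambda>x. L #> x) ` H)"
      using rH by auto
    moreover have "finite ((\<lambda>x. L #> x) ` H)"
      using fin(2) eq by (simp add: finite_index_def)
    ultimately show "finite ((\<lambda>x. (H #> x, L #> (x \<otimes> inv (r (H #> x))))) ` carrier G)"
      using finite_index_image_r_coset[OF fin(1)] finite_subset by blast
  next
    fix x y assume xy: "x \<in> carrier G" "y \<in> carrier G"
      and e: "(H #> x, L #> (x \<otimes> inv (r (H #> x)))) = (H #> y, L #> (y \<otimes> inv (r (H #> y))))"
    let ?r = "r (H #> x)"
    have rc: "?r \<in> carrier G" using r xy by blast
    have "L #> (x \<otimes> inv ?r) = L #> (y \<otimes> inv ?r)" using e by (metis prod.inject)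
    then have "x \<otimes> inv ?r \<otimes> inv (y \<otimes> inv ?r) \<in> L"
      using r_coset_eqD[OF L(1)] xy rc by simp
    also have "x \<otimes> inv ?r \<otimes> inv (y \<otimes> inv ?r) = x \<otimes> inv y"
      using xy rc by (simp add: inv_mult_group m_assoc) (simp flip: m_assoc)
    finally show "x \<otimes> inv y \<in> L" .
  qed (rule L)
qed

section \<open>Normal cores\<close>

lemma subgroup_normal_core:
  assumes "subgroup H G"
  shows "subgroup (normal_core G H) G"
proof (rule subgroupI)
  fix x y assume xy: "x \<in> normal_core G H" "y \<in> normal_core G H"
  have "g \<otimes> (x \<otimes> y) \<otimes> inv g \<in> H" if g: "g \<in> carrier G" for g
  proof -
    have "g \<otimes> (x \<otimes> y) \<otimes> inv g = (g \<otimes> x \<otimes> inv g) \<otimes> (g \<otimes> y \<otimes> inv g)"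
      using xy g by (simp add: normal_core_def m_assoc inv_mult_cancel)
    then show ?thesis
      using xy g assms by (auto simp: normal_core_def subgroup.m_closed)
  qed
  then show "x \<otimes> y \<in> normal_core G H"
    using xy by (auto simp: normal_core_def)
next
  fix x assume x: "x \<in> normal_core G H"
  have "g \<otimes> inv x \<otimes> inv g \<in> H" if g: "g \<in> carrier G" for g
  proof -
    have "g \<otimes> inv x \<otimes> inv g = inv (g \<otimes> x \<otimes> inv g)"
      using x g by (simp add: normal_core_def m_assoc inv_mult_group)
    then show ?thesis
      using x g assms by (auto simp: normal_core_def subgroup.m_inv_closed)
  qed
  then show "inv x \<in> normal_core G H"
    using x by (auto simp: normal_core_def)
next
  have "\<one> \<in> normal_core G H"
    using assms by (auto simp: normal_core_def subgroup.one_closed)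
  then show "normal_core G H \<noteq> {}" by blast
qed (auto simp: normal_core_def)

lemma normal_core_subset:
  assumes "subgroup H G"
  shows "normal_core G H \<subseteq> H"
proof
  fix x assume "x \<in> normal_core G H"
  then have "x \<in> carrier G" "\<one> \<otimes> x \<otimes> inv \<one> \<in> H"
    unfolding normal_core_def by blast+
  then show "x \<in> H" by simp
qed

lemma normal_normal_core:
  assumes "subgroup H G"
  shows "normal_core G H \<lhd> G"
proof (rule normal_invI)
  fix g x assume g: "g \<in> carrier G" and x: "x \<in> normal_core G H"
  have "h \<otimes> (g \<otimes> x \<otimes> inv g) \<otimes> inv h \<in> H" if h: "h \<in> carrier G" for h
  proof -
    have "h \<otimes> (g \<otimes> x \<otimes> inv g) \<otimes> inv h = (h \<otimes> g) \<otimes> x \<otimes> inv (h \<otimes> g)"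
      using x g h by (simp add: normal_core_def m_assoc inv_mult_group)
    then show ?thesis
      using x g h by (auto simp: normal_core_def)
  qed
  then show "g \<otimes> x \<otimes> inv g \<in> normal_core G H"
    using g x by (auto simp: normal_core_def)
qed (rule subgroup_normal_core[OF assms])

text \<open>The core contains the kernel of the action of \<open>G\<close> on the finite set of right cosets of \<open>H\<close>.\<close>

lemma finite_index_normal_core:
  assumes H: "subgroup H G" and fin: "finite_index G H"
  shows "finite_index G (normal_core G H)"
proof (rule finite_indexI[where f = "\<lambda>x. \<lambda>C\<in>rcosets H. C #> x"])
  have "C #> x \<in> rcosets H" if C: "C \<in> rcosets H" and x: "x \<in> carrier G" for C x
  proof -
    obtain g where "g \<in> carrier G" "C = H #> g"
      using C unfolding RCOSETS_def by blast
    then show ?thesis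
      using x rcosetsI[OF subgroup.subset[OF H], of "g \<otimes> x"] subgroup.subset[OF H]
      by (simp add: coset_mult_assoc)
  qed
  then have "(\<lambda>x. \<lambda>C\<in>rcosets H. C #> x) ` carrier G \<subseteq> rcosets H \<rightarrow>\<^sub>E rcosets H"
    by (intro image_subsetI restrict_PiE_iff[THEN iffD2]) blast
  moreover have "finite (rcosets H \<rightarrow>\<^sub>E rcosets H)"
    using fin by (simp add: finite_index_def finite_PiE)
  ultimately show "finite ((\<lambda>x. \<lambda>C\<in>rcosets H. C #> x) ` carrier G)"
    by (rule finite_subset)
next
  fix x y assume xy: "x \<in> carrier G" "y \<in> carrier G"
    and eq: "(\<lambda>C\<in>rcosets H. C #> x) = (\<lambda>C\<in>rcosets H. C #> y)"
  have "g \<otimes> (x \<otimes> inv y) \<otimes> inv g \<in> H" if g: "g \<in> carrier G" for g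
  proof -
    have "H #> g \<in> rcosets H" using g by (auto simp: RCOSETS_def)
    then have "H #> g #> x = H #> g #> y"
      using fun_cong[OF eq, of "H #> g"] by simp
    then have "H #> (g \<otimes> x) = H #> (g \<otimes> y)"
      using subgroup.subset[OF H] g xy by (simp add: coset_mult_assoc)
    then have "(g \<otimes> x) \<otimes> inv (g \<otimes> y) \<in> H"
      using r_coset_eqD[OF H] g xy by simp
    then show ?thesis
      using g xy by (simp add: m_assoc inv_mult_group)
  qed
  then show "x \<otimes> inv y \<in> normal_core G H"
    using xy by (auto simp: normal_core_def)
qed (rule subgroup_normal_core[OF H])

end

section \<open>Lower central series and finite index under homomorphisms\<close>

context group_hom
begin

text \<open>A homomorphism maps commutators to commutators and generated subgroups to generated
  subgroups. It is applied to inclusions, quotient maps and conjugations.\<close>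

lemma hom_lcs:
  assumes "A \<subseteq> carrier G"
  shows "h ` lcs G A i = lcs H (h ` A) i"
proof (induction i)
  case (Suc i)
  have sub: "lcs G A i \<subseteq> carrier G"
    using assms by (rule G.lcs_in_carrier)
  let ?S = "{a \<otimes> b \<otimes> inv a \<otimes> inv b | a b. a \<in> lcs G A i \<and> b \<in> A}"
  have S: "?S \<subseteq> carrier G" using G.commutators_in_carrier[OF sub assms] .
  have e: "h (a \<otimes> b \<otimes> inv a \<otimes> inv b) = h a \<otimes>\<^bsub>H\<^esub> h b \<otimes>\<^bsub>H\<^esub> inv\<^bsub>H\<^esub> h a \<otimes>\<^bsub>H\<^esub> inv\<^bsub>H\<^esub> h b"
    if "a \<in> lcs G A i" "b \<in> A" for a b
  proof -
    have "a \<in> carrier G" "b \<in> carrier G" using that sub assms by auto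
    then show ?thesis by simp
  qed
  have "h ` ?S = {a \<otimes>\<^bsub>H\<^esub> b \<otimes>\<^bsub>H\<^esub> inv\<^bsub>H\<^esub> a \<otimes>\<^bsub>H\<^esub> inv\<^bsub>H\<^esub> b | a b. a \<in> h ` lcs G A i \<and> b \<in> h ` A}"
    (is "_ = ?R")
  proof
    show "h ` ?S \<subseteq> ?R" using e by blast
    show "?R \<subseteq> h ` ?S"
    proof
      fix z assume "z \<in> ?R"
      then obtain a b where "a \<in> lcs G A i" "b \<in> A"
        "z = h a \<otimes>\<^bsub>H\<^esub> h b \<otimes>\<^bsub>H\<^esub> inv\<^bsub>H\<^esub> h a \<otimes>\<^bsub>H\<^esub> inv\<^bsub>H\<^esub> h b" by blast
      then have "z = h (a \<otimes> b \<otimes> inv a \<otimes> inv b)" "a \<otimes> b \<otimes> inv a \<otimes> inv b \<in> ?S"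
        using e[of a b] by auto
      then show "z \<in> h ` ?S" by blast
    qed
  qed
  then show ?case
    using generate_img[OF S] Suc by simp
qed simp

lemma finite_index_vimage:
  assumes "subgroup K H" "finite_index H K" "subgroup L G"
    and "{x \<in> carrier G. h x \<in> K} \<subseteq> L"
  shows "finite_index G L"
proof (rule G.finite_indexI[where f = "\<lambda>x. K #>\<^bsub>H\<^esub> h x"])
  have "(\<lambda>x. K #>\<^bsub>H\<^esub> h x) ` carrier G \<subseteq> (\<lambda>x. K #>\<^bsub>H\<^esub> x) ` carrier H"
    by auto
  then show "finite ((\<lambda>x. K #>\<^bsub>H\<^esub> h x) ` carrier G)"
    using H.finite_index_image_r_coset[OF assms(2)] finite_subset by blast
next
  fix x y assume xy: "x \<in> carrier G" "y \<in> carrier G" "K #>\<^bsub>H\<^esub> h x = K #>\<^bsub>H\<^esub> h y"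
  then have "h x \<otimes>\<^bsub>H\<^esub> inv\<^bsub>H\<^esub> h y \<in> K"
    using H.r_coset_eqD[OF assms(1)] by simp
  then show "x \<otimes> inv y \<in> L"
    using xy assms(4) by auto
qed (rule assms(3))

lemma finite_index_image:
  assumes "subgroup L G" "finite_index G L" and surj: "h ` carrier G = carrier H"
  shows "finite_index H (h ` L)"
proof -
  \<comment> \<open>A section \<open>s\<close> of \<open>h\<close> is chosen; \<open>y\<close> is
    then classified by the coset of \<open>s y\<close> modulo \<open>L\<close>.\<close>
  have "\<forall>y\<in>carrier H. \<exists>x. x \<in> carrier G \<and> h x = y"
    using surj by (metis imageE)
  then obtain s where s: "s y \<in> carrier G" "h (s y) = y" if "y \<in> carrier H" for y
    using bchoice[of "carrier H" "\<lambda>y x. x \<in> carrier G \<and> h x = y"] by metis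
  show ?thesis
  proof (rule H.finite_indexI[where f = "\<lambda>y. L #> s y"])
    have "(\<lambda>y. L #> s y) ` carrier H \<subseteq> (\<lambda>x. L #> x) ` carrier G"
      using s(1) by (metis image_image image_mono image_subsetI)
    then show "finite ((\<lambda>y. L #> s y) ` carrier H)"
      by (rule finite_subset) (rule G.finite_index_image_r_coset[OF assms(2)])
  next
    fix y z assume yz: "y \<in> carrier H" "z \<in> carrier H" "L #> s y = L #> s z"
    have "s y \<otimes> inv (s z) \<in> L"
      using G.r_coset_eqD[OF assms(1) s(1)[OF yz(1)] s(1)[OF yz(2)] yz(3)] .
    then have "h (s y \<otimes> inv (s z)) \<in> h ` L" by (rule imageI)
    then show "y \<otimes>\<^bsub>H\<^esub> inv\<^bsub>H\<^esub> z \<in> h ` L"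
      using s yz by simp
  qed (rule subgroup_img_is_subgroup[OF assms(1)])
qed

end

section \<open>Virtual nilpotency modulo a subset\<close>

lemma (in group) group_hom_incl:
  assumes "subgroup H G"
  shows "group_hom (G\<lparr>carrier := H\<rparr>) G id"
  using assms subgroup.subset[OF assms] subgroup.subgroup_is_group[OF assms group_axioms]
  by (auto simp: group_hom_def group_hom_axioms_def hom_def group_axioms)

text \<open>From left to right finite index is transitive; from right to left the witness is cut
  down to \<open>L \<inter> H\<close>. The inclusion is a homomorphism, so lower central terms agree
  in both groups. Statements about subgroups of finite index can thus be read in
  \<open>G\<close>.\<close>

lemma (in group) virt_nilpotent_mod_subgroup:
  assumes H: "subgroup H G" "finite_index G H" and N: "N \<subseteq> H"
  shows "virt_nilpotent_mod c (G\<lparr>carrier := H\<rparr>) N \<longleftrightarrow> virt_nilpotent_mod c G N"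
proof
  interpret i: group_hom "G\<lparr>carrier := H\<rparr>" G id
    using H(1) by (rule group_hom_incl)
  {
    assume "virt_nilpotent_mod c (G\<lparr>carrier := H\<rparr>) N"
    then obtain L where L: "subgroup L (G\<lparr>carrier := H\<rparr>)" "finite_index (G\<lparr>carrier := H\<rparr>) L"
      "lcs (G\<lparr>carrier := H\<rparr>) L c \<subseteq> N"
      unfolding virt_nilpotent_mod_def by blast
    have LH: "L \<subseteq> H" using subgroup.subset[OF L(1)] by simp
    have LG: "subgroup L G" using incl_subgroup[OF H(1) L(1)] .
    have "lcs G L c \<subseteq> N" using i.hom_lcs[of L c] L(3) LH by simp
    then show "virt_nilpotent_mod c G N"
      using finite_index_trans[OF H(1) LG LH H(2) L(2)] LG unfolding virt_nilpotent_mod_def by blast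
  }
  {
    assume "virt_nilpotent_mod c G N"
    then obtain L where L: "subgroup L G" "finite_index G L" "lcs G L c \<subseteq> N"
      unfolding virt_nilpotent_mod_def by blast
    have LH: "subgroup (L \<inter> H) (G\<lparr>carrier := H\<rparr>)"
      using subgroup_incl[of "L \<inter> H" H] subgroups_Inter_pair L(1) H(1) by simp
    have "finite_index (G\<lparr>carrier := H\<rparr>) (L \<inter> H)"
      by (rule i.finite_index_vimage[OF L(1,2) LH]) auto
    moreover have "lcs (G\<lparr>carrier := H\<rparr>) (L \<inter> H) c \<subseteq> N"
      using i.hom_lcs[of "L \<inter> H" c] L(3) lcs_mono[of "L \<inter> H" L c] by simp
    ultimately show "virt_nilpotent_mod c (G\<lparr>carrier := H\<rparr>) N"
      using LH unfolding virt_nilpotent_mod_def by blast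
  }
qed

text \<open>A witness in \<open>H\<close> is pulled back and a witness in \<open>G\<close> is pushed
  forward along \<open>h\<close>; a lower central term is killed by \<open>h\<close> exactly when it
  lies in the kernel.\<close>

lemma (in group_hom) virt_nilpotent_mod_surj:
  assumes surj: "h ` carrier G = carrier H"
  shows "virt_nilpotent_mod c H {\<one>\<^bsub>H\<^esub>} \<longleftrightarrow> virt_nilpotent_mod c G (kernel G H h)"
proof
  assume "virt_nilpotent_mod c H {\<one>\<^bsub>H\<^esub>}"
  then obtain K where K: "subgroup K H" "finite_index H K" "lcs H K c \<subseteq> {\<one>\<^bsub>H\<^esub>}"
    unfolding virt_nilpotent_mod_def by blast
  define L where "L = {x \<in> carrier G. h x \<in> K}"
  have L: "subgroup L G"
  proof (rule G.subgroupI)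
    have "\<one> \<in> L" using subgroup.one_closed[OF K(1)] by (simp add: L_def)
    then show "L \<noteq> {}" by blast
  qed (auto simp: L_def subgroup.m_closed[OF K(1)] subgroup.m_inv_closed[OF K(1)])
  have LK: "h ` L \<subseteq> K" by (auto simp: L_def)
  have "finite_index G L"
    by (rule finite_index_vimage[OF K(1,2) L]) (simp add: L_def)
  moreover have "h ` lcs G L c \<subseteq> {\<one>\<^bsub>H\<^esub>}"
    using hom_lcs[OF subgroup.subset[OF L], of c] H.lcs_mono[OF LK, of c] K(3) by (metis order_trans)
  then have "lcs G L c \<subseteq> kernel G H h"
    using G.lcs_in_carrier[OF subgroup.subset[OF L], of c] unfolding kernel_def by blast
  ultimately show "virt_nilpotent_mod c G (kernel G H h)"
    using L unfolding virt_nilpotent_mod_def by blast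
next
  assume "virt_nilpotent_mod c G (kernel G H h)"
  then obtain L where L: "subgroup L G" "finite_index G L" "lcs G L c \<subseteq> kernel G H h"
    unfolding virt_nilpotent_mod_def by blast
  have "h ` lcs G L c \<subseteq> {\<one>\<^bsub>H\<^esub>}"
    using L(3) unfolding kernel_def by blast
  then have "lcs H (h ` L) c \<subseteq> {\<one>\<^bsub>H\<^esub>}"
    using hom_lcs[OF subgroup.subset[OF L(1)], of c] by simp
  then show "virt_nilpotent_mod c H {\<one>\<^bsub>H\<^esub>}"
    using finite_index_image[OF L(1,2) surj] subgroup_img_is_subgroup[OF L(1)]
    unfolding virt_nilpotent_mod_def by blast
qed

text \<open>The projection has kernel \<open>N\<close>, and \<open>N\<close> itself is the identity
  of \<open>G Mod N\<close>.\<close>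

lemma (in group) virt_nilpotent_mod_FactGroup:
  assumes N: "N \<lhd> G"
  shows "virt_nilpotent_mod c (G Mod N) {N} \<longleftrightarrow> virt_nilpotent_mod c G N"
proof -
  have hom: "group_hom G (G Mod N) (\<lambda>x. N #> x)"
    unfolding group_hom_def group_hom_axioms_def
    by (intro conjI group_axioms normal.r_coset_hom_Mod[OF N] normal.factorgroup_is_group[OF N])
  have sub: "subgroup N G" using N by (rule normal_imp_subgroup)
  have "kernel G (G Mod N) (\<lambda>x. N #> x) = N"
  proof
    show "kernel G (G Mod N) (\<lambda>x. N #> x) \<subseteq> N"
      using rcos_self[OF _ sub] unfolding kernel_def one_FactGroup by blast
    show "N \<subseteq> kernel G (G Mod N) (\<lambda>x. N #> x)"
      using coset_join2[OF _ sub] subgroup.subset[OF sub] unfolding kernel_def one_FactGroup by blast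
  qed
  then show ?thesis
    using group_hom.virt_nilpotent_mod_surj[OF hom, of c] by (simp add: carrier_FactGroup)
qed

section \<open>Topological groups\<close>

context topological_group
begin

lemma continuous_map_mult:
  assumes "continuous_map X T f" "continuous_map X T g"
  shows "continuous_map X T (\<lambda>x. f x \<otimes> g x)"
  using continuous_map_compose[OF continuous_map_pairedI[OF assms] continuous_mult]
  by (simp add: o_def)

lemma continuous_map_inv:
  assumes "continuous_map X T f"
  shows "continuous_map X T (\<lambda>x. inv (f x))"
  using continuous_map_compose[OF assms continuous_inv] by (simp add: o_def)

lemma continuous_map_const_carrier: "a \<in> carrier G \<Longrightarrow> continuous_map X T (\<lambda>_. a)"
  by (simp add: topspace_eq)

lemmas continuous_map_group = continuous_map_mult continuous_map_inv continuous_map_const_carrier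
  continuous_map_fst continuous_map_snd continuous_map_id[unfolded id_def]

lemma closedin_subset_carrier: "closedin T S \<Longrightarrow> S \<subseteq> carrier G"
  using closedin_subset[of T S] by (simp add: topspace_eq)

lemma closure_subset_carrier: "T closure_of S \<subseteq> carrier G"
  using closure_of_subset_topspace[of T S] by (simp add: topspace_eq)

lemma subset_closure: "S \<subseteq> carrier G \<Longrightarrow> S \<subseteq> T closure_of S"
  using closure_of_subset[of S T] by (simp add: topspace_eq)

lemma closedin_vimage:
  assumes "continuous_map T T f" "closedin T C"
  shows "closedin T {x \<in> carrier G. f x \<in> C}"
  using closedin_continuous_map_preimage[OF assms] by (simp add: topspace_eq)

text \<open>The closure of \<open>A \<times> B\<close> is the product of the closures, so joint
  continuity of \<open>f\<close> applies. The uses are multiplication and the commutator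
  map.\<close>

lemma closure_of_binary:
  assumes f: "continuous_map (prod_topology T T) T (\<lambda>p. f (fst p) (snd p))"
    and AB: "\<And>a b. \<lbrakk>a \<in> A; b \<in> B\<rbrakk> \<Longrightarrow> f a b \<in> C"
    and ab: "a \<in> T closure_of A" "b \<in> T closure_of B"
  shows "f a b \<in> T closure_of C"
proof -
  have "(a, b) \<in> prod_topology T T closure_of (A \<times> B)"
    using ab by (simp add: closure_of_Times)
  then have "f a b \<in> T closure_of ((\<lambda>p. f (fst p) (snd p)) ` (A \<times> B))"
    using continuous_map_image_closure_subset[OF f, of "A \<times> B"] by force
  moreover have "(\<lambda>p. f (fst p) (snd p)) ` (A \<times> B) \<subseteq> C"
    using AB by auto
  ultimately show ?thesis
    using closure_of_mono by blast
qed

lemma closure_of_unary: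
  assumes f: "continuous_map T T f" and "\<And>a. a \<in> A \<Longrightarrow> f a \<in> C" and "a \<in> T closure_of A"
  shows "f a \<in> T closure_of C"
proof -
  have "f a \<in> T closure_of (f ` A)"
    using continuous_map_image_closure_subset[OF f] assms(3) by blast
  moreover have "f ` A \<subseteq> C" using assms(2) by blast
  ultimately show ?thesis using closure_of_mono by blast
qed

section \<open>Closures and virtual nilpotency\<close>

lemma subgroup_closure:
  assumes "subgroup H G"
  shows "subgroup (T closure_of H) G"
proof (rule subgroupI)
  show "T closure_of H \<noteq> {}"
    using subset_closure[OF subgroup.subset[OF assms]] subgroup.one_closed[OF assms] by blast
  show "inv a \<in> T closure_of H" if "a \<in> T closure_of H" for a
    using that by (rule closure_of_unary[rotated 2])
      (use assms in \<open>auto intro: continuous_inv subgroup.m_inv_closed\<close>)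
  show "a \<otimes> b \<in> T closure_of H" if "a \<in> T closure_of H" "b \<in> T closure_of H" for a b
    by (rule closure_of_binary[of "\<lambda>a b. a \<otimes> b", OF _ _ that])
      (use assms in \<open>auto intro: continuous_map_group subgroup.m_closed\<close>)
qed (rule closure_subset_carrier)

lemma lcs_subset_lower_central:
  assumes "subgroup H G"
  shows "lcs G H i \<subseteq> lower_central G T H i"
proof (induction i)
  case (Suc i)
  let ?S = "\<lambda>A. {a \<otimes> b \<otimes> inv a \<otimes> inv b | a b. a \<in> A \<and> b \<in> H}"
  have H: "H \<subseteq> carrier G" using assms by (rule subgroup.subset)
  have lc: "lower_central G T H i \<subseteq> carrier G"
    by (cases i) (use H closure_subset_carrier in \<open>auto simp: closed_commutator_def\<close>)
  have "lcs G H (Suc i) = generate G (?S (lcs G H i))" by simp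
  also have "\<dots> \<subseteq> generate G (?S (lower_central G T H i))"
    by (rule mono_generate) (use Suc in blast)
  also have "\<dots> \<subseteq> T closure_of \<dots>"
    by (rule subset_closure) (rule generate_incl[OF commutators_in_carrier[OF lc H]])
  also have "\<dots> = lower_central G T H (Suc i)"
    by (simp add: closed_commutator_def)
  finally show ?case .
qed simp

text \<open>By continuity of the commutator map, commutators of elements of two closures lie in the
  closure of the next abstract term. Inductively, taking closures at every stage yields nothing
  outside the closure of the abstract series.\<close>

lemma lower_central_closure_subset:
  assumes "subgroup H G"
  shows "lower_central G T (T closure_of H) i \<subseteq> T closure_of lcs G H i"
proof (induction i)
  case (Suc i)
  have H: "H \<subseteq> carrier G" using assms by (rule subgroup.subset)
  have "a \<otimes> b \<otimes> inv a \<otimes> inv b \<in> T closure_of lcs G H (Suc i)"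
    if a: "a \<in> T closure_of lcs G H i" and b: "b \<in> T closure_of H" for a b
  proof (rule closure_of_binary[of "\<lambda>a b. a \<otimes> b \<otimes> inv a \<otimes> inv b", OF _ _ a b])
    show "continuous_map (prod_topology T T) T
        (\<lambda>p. fst p \<otimes> snd p \<otimes> inv fst p \<otimes> inv snd p)"
      by (intro continuous_map_group)
    show "a \<otimes> b \<otimes> inv a \<otimes> inv b \<in> lcs G H (Suc i)" if "a \<in> lcs G H i" "b \<in> H" for a b
      unfolding lcs.simps by (rule generate.incl) (use that in blast)
  qed
  then have "generate G {a \<otimes> b \<otimes> inv a \<otimes> inv b | a b.
      a \<in> lower_central G T (T closure_of H) i \<and> b \<in> T closure_of H} \<subseteq> T closure_of lcs G H (Suc i)"
    by (intro generate_subgroup_incl subgroup_closure lcs_subgroup assms) (use Suc in blast)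
  then show ?case
    by (simp add: closed_commutator_def closure_of_minimal)
qed simp

text \<open>A closed witness is also an abstract one, since the abstract terms lie in the closed
  ones. Conversely the closure of an abstract witness works: term \<open>c\<close> of its closed
  series lies in the closure of a subset of \<open>{\<one>}\<close>, which is already
  closed.\<close>

lemma virtually_nilpotent_iff:
  assumes closed_one: "closedin T {\<one>}"
  shows "virtually_nilpotent c G T \<longleftrightarrow> virt_nilpotent_mod c G {\<one>}"
proof
  assume "virtually_nilpotent c G T"
  then obtain H where "subgroup H G" "finite_index G H" "lower_central G T H c = {\<one>}"
    unfolding virtually_nilpotent_def closed_subgroup_def by blast
  then show "virt_nilpotent_mod c G {\<one>}"
    using lcs_subset_lower_central unfolding virt_nilpotent_mod_def by metis
next
  assume "virt_nilpotent_mod c G {\<one>}"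
  then obtain H where H: "subgroup H G" "finite_index G H" "lcs G H c \<subseteq> {\<one>}"
    unfolding virt_nilpotent_mod_def by blast
  let ?C = "T closure_of H"
  have C: "subgroup ?C G" using H(1) by (rule subgroup_closure)
  have "T closure_of lcs G H c \<subseteq> {\<one>}"
    using H(3) closed_one by (rule closure_of_minimal)
  then have "lower_central G T ?C c \<subseteq> {\<one>}"
    using lower_central_closure_subset[OF H(1), of c] by blast
  moreover have "\<one> \<in> lower_central G T ?C c"
    using lcs_subset_lower_central[OF C, of c] subgroup.one_closed[OF lcs_subgroup[OF C]] by blast
  ultimately have "lower_central G T ?C c = {\<one>}" by blast
  moreover have "finite_index G ?C"
    using finite_index_mono[OF H(1) C _ H(2)] subset_closure[OF subgroup.subset[OF H(1)]] by blast
  ultimately show "virtually_nilpotent c G T"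
    using C closedin_closure_of[of T H] unfolding virtually_nilpotent_def closed_subgroup_def by blast
qed

section \<open>Subgroups and quotients as topological groups\<close>

lemma topological_group_subgroup:
  assumes "subgroup H G"
  shows "topological_group (G\<lparr>carrier := H\<rparr>) (subtopology T H)"
proof -
  have H: "H \<subseteq> carrier G" using assms by (rule subgroup.subset)
  interpret S: group "G\<lparr>carrier := H\<rparr>"
    using subgroup.subgroup_is_group[OF assms group_axioms] .
  have top: "topspace (subtopology T H) = H"
    using H topspace_eq by auto
  show ?thesis
  proof
    show "topspace (subtopology T H) = carrier (G\<lparr>carrier := H\<rparr>)" using top by simp
    have "continuous_map (subtopology (prod_topology T T) (H \<times> H)) (subtopology T H) (\<lambda>(x, y). x \<otimes> y)"
      by (intro continuous_map_into_subtopology continuous_map_from_subtopology continuous_mult)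
        (use subgroup.m_closed[OF assms] in auto)
    then show "continuous_map (prod_topology (subtopology T H) (subtopology T H)) (subtopology T H)
        (\<lambda>(x, y). x \<otimes>\<^bsub>G\<lparr>carrier := H\<rparr>\<^esub> y)"
      by (simp add: subtopology_Times)
    have "continuous_map (subtopology T H) (subtopology T H) (\<lambda>x. inv x)"
      by (intro continuous_map_into_subtopology continuous_map_from_subtopology continuous_inv)
        (use subgroup.m_inv_closed[OF assms] in auto)
    then show "continuous_map (subtopology T H) (subtopology T H) (\<lambda>x. inv\<^bsub>G\<lparr>carrier := H\<rparr>\<^esub> x)"
      by (rule continuous_map_eq) (simp add: top m_inv_consistent[OF assms])
  qed
qed

text \<open>The preimage of the image of \<open>U\<close> is the union of the translates of
  \<open>U\<close> by elements of \<open>N\<close>, and translations are continuous.\<close>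

lemma open_map_quotient_group_topology:
  assumes N: "N \<lhd> G"
  shows "open_map T (quotient_group_topology G T N) (\<lambda>x. N #> x)"
  unfolding open_map_def
proof (intro allI impI)
  fix U assume U: "openin T U"
  have sub: "subgroup N G" using N by (rule normal_imp_subgroup)
  have UG: "U \<subseteq> carrier G" using openin_subset[OF U] by (simp add: topspace_eq)
  have "{g \<in> carrier G. N #> g \<in> (\<lambda>x. N #> x) ` U} = (\<Union>n\<in>N. {g \<in> carrier G. n \<otimes> g \<in> U})"
  proof (intro equalityI subsetI)
    fix g assume "g \<in> {g \<in> carrier G. N #> g \<in> (\<lambda>x. N #> x) ` U}"
    then obtain u where g: "g \<in> carrier G" and u: "u \<in> U" "N #> u = N #> g" by auto
    then have "u \<otimes> inv g \<in> N" "u \<otimes> inv g \<otimes> g = u"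
      using r_coset_eqD[OF sub] UG by (auto simp: m_assoc)
    then show "g \<in> (\<Union>n\<in>N. {g \<in> carrier G. n \<otimes> g \<in> U})"
      using g u(1) by force
  next
    fix g assume "g \<in> (\<Union>n\<in>N. {g \<in> carrier G. n \<otimes> g \<in> U})"
    then obtain n where n: "n \<in> N" "g \<in> carrier G" "n \<otimes> g \<in> U" by blast
    then have "N #> (n \<otimes> g) = N #> g"
      using coset_mult_assoc[of N n g] coset_join2[OF _ sub n(1)] subgroup.subset[OF sub] by auto
    then show "g \<in> {g \<in> carrier G. N #> g \<in> (\<lambda>x. N #> x) ` U}"
      using n by (metis (mono_tags, lifting) imageI mem_Collect_eq)
  qed
  moreover have "openin T {g \<in> carrier G. n \<otimes> g \<in> U}" if "n \<in> N" for n
  proof -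
    have "continuous_map T T (\<lambda>g. n \<otimes> g)"
      by (intro continuous_map_group) (use that subgroup.subset[OF sub] in blast)
    from openin_continuous_map_preimage[OF this U] show ?thesis
      by (simp add: topspace_eq)
  qed
  then have "openin T (\<Union>n\<in>N. {g \<in> carrier G. n \<otimes> g \<in> U})"
    by blast
  ultimately have "openin T {g \<in> carrier G. N #> g \<in> (\<lambda>x. N #> x) ` U}"
    by (simp only:)
  then show "openin (quotient_group_topology G T N) ((\<lambda>x. N #> x) ` U)"
    using image_mono[OF UG] by (simp add: openin_quotient_group_topology carrier_FactGroup)
qed

text \<open>A product of quotient maps need not be a quotient map, so continuity of multiplication
  is checked on open boxes, using that the projection is open.\<close>

lemma topological_group_quotient:
  assumes N: "N \<lhd> G"
  shows "topological_group (G Mod N) (quotient_group_topology G T N)"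
proof -
  let ?Q = "quotient_group_topology G T N"
  interpret Q: group "G Mod N"
    using normal.factorgroup_is_group[OF N] .
  have top: "topspace ?Q = carrier (G Mod N)"
    by (rule topspace_quotient_group_topology[OF topspace_eq])
  have q: "quotient_map T ?Q (\<lambda>x. N #> x)"
    by (rule quotient_map_quotient_group_topology[OF topspace_eq])
  have mult: "(N #> x) \<otimes>\<^bsub>G Mod N\<^esub> (N #> y) = N #> (x \<otimes> y)"
    if "x \<in> carrier G" "y \<in> carrier G" for x y
    using normal.rcos_sum[OF N that] by simp
  show ?thesis
  proof
    show "topspace ?Q = carrier (G Mod N)" by (rule top)
    show "continuous_map (prod_topology ?Q ?Q) ?Q (\<lambda>(x, y). x \<otimes>\<^bsub>G Mod N\<^esub> y)"
      unfolding continuous_map_def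
    proof (intro conjI allI impI)
      show "(\<lambda>(x, y). x \<otimes>\<^bsub>G Mod N\<^esub> y) \<in> topspace (prod_topology ?Q ?Q) \<rightarrow> topspace ?Q"
      proof (rule Pi_I)
        fix p assume "p \<in> topspace (prod_topology ?Q ?Q)"
        then have "fst p \<in> carrier (G Mod N)" "snd p \<in> carrier (G Mod N)"
          by (simp_all add: top mem_Times_iff)
        then show "(\<lambda>(x, y). x \<otimes>\<^bsub>G Mod N\<^esub> y) p \<in> topspace ?Q"
          unfolding top case_prod_beta by (rule Q.m_closed)
      qed
      fix U assume "openin ?Q U"
      then have U: "openin T {g \<in> carrier G. N #> g \<in> U}"
        unfolding openin_quotient_group_topology by blast
      have "openin (prod_topology T T)
          {p \<in> topspace (prod_topology T T). (\<lambda>(x, y). x \<otimes> y) p \<in> {g \<in> carrier G. N #> g \<in> U}}"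
        by (rule openin_continuous_map_preimage[OF continuous_mult U])
      then have W: "openin (prod_topology T T)
          {(x, y). x \<in> carrier G \<and> y \<in> carrier G \<and> N #> (x \<otimes> y) \<in> U}" (is "openin _ ?W")
        by (rule back_subst[of "openin _"]) (auto simp: topspace_eq)
      show "openin (prod_topology ?Q ?Q)
          {p \<in> topspace (prod_topology ?Q ?Q). (\<lambda>(x, y). x \<otimes>\<^bsub>G Mod N\<^esub> y) p \<in> U}"
        unfolding openin_prod_topology_alt
      proof (intro allI impI)
        fix P R assume "(P, R) \<in> {p \<in> topspace (prod_topology ?Q ?Q). (\<lambda>(x, y). x \<otimes>\<^bsub>G Mod N\<^esub> y) p \<in> U}"
        then have PR: "P \<in> carrier (G Mod N)" "R \<in> carrier (G Mod N)" "P \<otimes>\<^bsub>G Mod N\<^esub> R \<in> U"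
          by (auto simp: top)
        obtain x y where x: "x \<in> carrier G" "P = N #> x" and y: "y \<in> carrier G" "R = N #> y"
          using imageE[OF PR(1)[unfolded carrier_FactGroup]] imageE[OF PR(2)[unfolded carrier_FactGroup]]
          by metis
        have "N #> (x \<otimes> y) \<in> U"
          using PR(3) by (simp only: x(2) y(2) mult[OF x(1) y(1)])
        with x(1) y(1) have xy: "(x, y) \<in> ?W" by simp
        from W[unfolded openin_prod_topology_alt, rule_format, OF xy]
        obtain A B where AB: "openin T A" "openin T B" "x \<in> A" "y \<in> B" "A \<times> B \<subseteq> ?W"
          by (elim exE conjE)
        \<comment> \<open>The projection, being open, turns the box around \<open>(x, y)\<close>
          into a box around \<open>(P, R)\<close>.\<close>
        have "openin ?Q ((\<lambda>x. N #> x) ` A)" "openin ?Q ((\<lambda>x. N #> x) ` B)"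
          by (intro open_map_quotient_group_topology[OF N, unfolded open_map_def, rule_format] AB)+
        moreover have "((\<lambda>x. N #> x) ` A) \<times> ((\<lambda>x. N #> x) ` B) \<subseteq>
            {p \<in> topspace (prod_topology ?Q ?Q). (\<lambda>(x, y). x \<otimes>\<^bsub>G Mod N\<^esub> y) p \<in> U}"
        proof clarify
          fix a b assume "a \<in> A" "b \<in> B"
          then have "a \<in> carrier G" "b \<in> carrier G" "N #> (a \<otimes> b) \<in> U" using AB(5) by auto
          then show "(N #> a, N #> b) \<in> topspace (prod_topology ?Q ?Q) \<and>
              (N #> a) \<otimes>\<^bsub>G Mod N\<^esub> (N #> b) \<in> U"
            unfolding mult[OF \<open>a \<in> carrier G\<close> \<open>b \<in> carrier G\<close>] by (auto simp: top carrier_FactGroup)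
        qed
        ultimately show "\<exists>V W. openin ?Q V \<and> openin ?Q W \<and> P \<in> V \<and> R \<in> W \<and> V \<times> W \<subseteq>
            {p \<in> topspace (prod_topology ?Q ?Q). (\<lambda>(x, y). x \<otimes>\<^bsub>G Mod N\<^esub> y) p \<in> U}"
          using x(2) y(2) AB(3,4) by blast
      qed
    qed
    \<comment> \<open>For inversion the universal property of the quotient map suffices: the
      composite with the projection is continuous on \<open>G\<close>.\<close>
    have "continuous_map T ?Q ((\<lambda>x. N #> x) \<circ> (\<lambda>x. inv x))"
      by (rule continuous_map_compose[OF continuous_inv quotient_imp_continuous_map[OF q]])
    then have "continuous_map T ?Q ((\<lambda>X. inv\<^bsub>G Mod N\<^esub> X) \<circ> (\<lambda>x. N #> x))"
    proof (rule continuous_map_eq)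
      fix x assume "x \<in> topspace T"
      then have x: "x \<in> carrier G" by (simp add: topspace_eq)
      then have "N #> x \<in> carrier (G Mod N)" by (auto simp: carrier_FactGroup)
      then show "((\<lambda>x. N #> x) \<circ> (\<lambda>x. inv x)) x = ((\<lambda>X. inv\<^bsub>G Mod N\<^esub> X) \<circ> (\<lambda>x. N #> x)) x"
        using normal.inv_FactGroup[OF N] normal.rcos_inv[OF N x] by simp
    qed
    then show "continuous_map ?Q ?Q (\<lambda>X. inv\<^bsub>G Mod N\<^esub> X)"
      using continuous_compose_quotient_map_eq[OF q] by blast
  qed
qed

text \<open>The preimage of the point \<open>N\<close> of the quotient is the subset
  \<open>N\<close> of \<open>G\<close>.\<close>

lemma closedin_one_quotient:
  assumes N: "N \<lhd> G" and closed: "closedin T N"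
  shows "closedin (quotient_group_topology G T N) {N}"
proof -
  have sub: "subgroup N G" using N by (rule normal_imp_subgroup)
  have "{x \<in> topspace T. N #> x \<in> {N}} = N"
    using rcos_self[OF _ sub] coset_join2[OF _ sub] subgroup.subset[OF sub]
    by (auto simp: topspace_eq)
  moreover have "{N} \<subseteq> topspace (quotient_group_topology G T N)"
    using topspace_quotient_group_topology[OF topspace_eq] normal.factorgroup_is_group[OF N]
      monoid.one_closed[OF group.is_monoid, of "G Mod N"] by auto
  ultimately show ?thesis
    using quotient_map_quotient_group_topology[OF topspace_eq, of N] closed
    unfolding quotient_map_closedin by metis
qed

text \<open>Quotient topologies disappear here: what remains of the topology is the closedness of
  the normal subgroups \<open>N\<close>.\<close>

lemma JNNF_iff:
  assumes closed_one: "closedin T {\<one>}"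
  shows "JNNF c G T \<longleftrightarrow> \<not> virt_nilpotent_mod c G {\<one>} \<and>
    (\<forall>N. closed_normal G T N \<and> N \<noteq> {\<one>} \<longrightarrow> virt_nilpotent_mod c G N)"
proof -
  have "virtually_nilpotent c (G Mod N) (quotient_group_topology G T N) \<longleftrightarrow> virt_nilpotent_mod c G N"
    if "closed_normal G T N" for N
  proof -
    have N: "N \<lhd> G" "closedin T N" using that unfolding closed_normal_def by auto
    show ?thesis
      using topological_group.virtually_nilpotent_iff[OF topological_group_quotient[OF N(1)], of c]
        closedin_one_quotient[OF N] virt_nilpotent_mod_FactGroup[OF N(1), of c]
      by simp
  qed
  then show ?thesis
    unfolding JNNF_def virtually_nilpotent_iff[OF closed_one] by blast
qed

end

section \<open>Conjugates, centralizers and basal subgroups\<close>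

context group
begin

section \<open>Conjugation and normalized subsets\<close>

lemma normal_iff_normalizes: "N \<lhd> G \<longleftrightarrow> subgroup N G \<and> normalizes G (carrier G) N"
  by (simp add: normal_inv_iff normalizes_def)

lemma normalizesD: "\<lbrakk>normalizes G U A; u \<in> U; a \<in> A\<rbrakk> \<Longrightarrow> u \<otimes> a \<otimes> inv u \<in> A"
  by (simp add: normalizes_def)

lemma normalizes_Int: "\<lbrakk>normalizes G U A; normalizes G U B\<rbrakk> \<Longrightarrow> normalizes G U (A \<inter> B)"
  by (simp add: normalizes_def)

lemma normalizes_mono: "\<lbrakk>normalizes G U A; V \<subseteq> U\<rbrakk> \<Longrightarrow> normalizes G V A"
  by (auto simp: normalizes_def)

lemma subgroup_normalizes_subset:
  "\<lbrakk>subgroup A G; U \<subseteq> A\<rbrakk> \<Longrightarrow> normalizes G U A"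
  unfolding normalizes_def
  by (intro ballI subgroup.m_closed[of A G] subgroup.m_inv_closed[of A G]) auto

lemma group_hom_conj:
  assumes "g \<in> carrier G"
  shows "group_hom G G (\<lambda>x. g \<otimes> x \<otimes> inv g)"
proof -
  have "g \<otimes> (x \<otimes> y) \<otimes> inv g = g \<otimes> x \<otimes> inv g \<otimes> (g \<otimes> y \<otimes> inv g)"
    if "x \<in> carrier G" "y \<in> carrier G" for x y
    using assms that by (simp add: m_assoc inv_mult_cancel)
  then show ?thesis
    using assms by (auto simp: group_hom_def group_hom_axioms_def hom_def group_axioms)
qed

lemma conj_set_in_carrier: "\<lbrakk>g \<in> carrier G; A \<subseteq> carrier G\<rbrakk> \<Longrightarrow> conj_set G g A \<subseteq> carrier G"
  by (auto simp: conj_set_def subset_iff)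

lemma subgroup_conj_set: "\<lbrakk>g \<in> carrier G; subgroup A G\<rbrakk> \<Longrightarrow> subgroup (conj_set G g A) G"
  unfolding conj_set_def by (rule group_hom.subgroup_img_is_subgroup[OF group_hom_conj])

lemma conj_set_mono: "A \<subseteq> B \<Longrightarrow> conj_set G g A \<subseteq> conj_set G g B"
  unfolding conj_set_def by (rule image_mono)

lemma conj_set_mult:
  assumes "g \<in> carrier G" "h \<in> carrier G" "A \<subseteq> carrier G"
  shows "conj_set G g (conj_set G h A) = conj_set G (g \<otimes> h) A"
proof -
  have "g \<otimes> (h \<otimes> x \<otimes> inv h) \<otimes> inv g = g \<otimes> h \<otimes> x \<otimes> inv (g \<otimes> h)" if "x \<in> A" for x
    using that assms by (simp add: subset_iff m_assoc inv_mult_group)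
  then show ?thesis
    by (simp add: conj_set_def image_image cong: image_cong)
qed

lemma conj_set_one: "A \<subseteq> carrier G \<Longrightarrow> conj_set G \<one> A = A"
  by (force simp: conj_set_def subset_iff)

text \<open>The preimage form shows that conjugation commutes with intersections and preserves
  closedness.\<close>

lemma conj_set_eq_vimage:
  assumes "g \<in> carrier G" "A \<subseteq> carrier G"
  shows "conj_set G g A = {x \<in> carrier G. inv g \<otimes> x \<otimes> g \<in> A}"
proof (intro equalityI subsetI)
  fix x assume "x \<in> conj_set G g A"
  then obtain a where a: "a \<in> A" "x = g \<otimes> a \<otimes> inv g" by (auto simp: conj_set_def)
  then have "a \<in> carrier G" using assms by blast
  then show "x \<in> {x \<in> carrier G. inv g \<otimes> x \<otimes> g \<in> A}"
    using a assms by (simp add: m_assoc inv_mult_cancel)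
next
  fix x assume x: "x \<in> {x \<in> carrier G. inv g \<otimes> x \<otimes> g \<in> A}"
  then have "x = g \<otimes> (inv g \<otimes> x \<otimes> g) \<otimes> inv g"
    using assms by (simp add: m_assoc inv_mult_cancel)
  then show "x \<in> conj_set G g A"
    unfolding conj_set_def by (rule image_eqI) (use x in simp)
qed

lemma conj_set_cancel:
  assumes "g \<in> carrier G" "A \<subseteq> carrier G"
  shows "conj_set G (inv g) (conj_set G g A) = A"
  using assms by (simp add: conj_set_mult conj_set_one)

lemma normalizes_iff_conj_set: "normalizes G U A \<longleftrightarrow> (\<forall>u\<in>U. conj_set G u A \<subseteq> A)"
  by (auto simp: normalizes_def conj_set_def)

text \<open>The reverse inclusion comes from conjugating the inclusion for \<open>inv u\<close> by
  \<open>u\<close>.\<close>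

lemma conj_set_eq_self:
  assumes U: "subgroup U G" "u \<in> U" and A: "A \<subseteq> carrier G" "normalizes G U A"
  shows "conj_set G u A = A"
proof
  have u: "u \<in> carrier G" using subgroup.subset[OF U(1)] U(2) by blast
  show "conj_set G u A \<subseteq> A"
    using A(2) U(2) by (simp add: normalizes_iff_conj_set)
  have "conj_set G (inv u) A \<subseteq> A"
    using A(2) subgroup.m_inv_closed[OF U] by (simp add: normalizes_iff_conj_set)
  then have "conj_set G u (conj_set G (inv u) A) \<subseteq> conj_set G u A"
    by (rule conj_set_mono)
  then show "A \<subseteq> conj_set G u A"
    using conj_set_cancel[of "inv u" A] u A(1) by simp
qed

text \<open>Write \<open>u \<otimes> g\<close> as \<open>g \<otimes> v\<close> with
  \<open>v = inv g \<otimes> u \<otimes> g\<close>, which lies in \<open>U\<close> by normality and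
  so normalizes \<open>A\<close>.\<close>

lemma normalizes_conj_set:
  assumes U: "U \<lhd> G" and A: "A \<subseteq> carrier G" "normalizes G U A" and g: "g \<in> carrier G"
  shows "normalizes G U (conj_set G g A)"
  unfolding normalizes_iff_conj_set
proof
  fix u assume u: "u \<in> U"
  have uG: "u \<in> carrier G"
    using u subgroup.subset[OF normal_imp_subgroup[OF U]] by blast
  have v: "inv g \<otimes> u \<otimes> g \<in> U"
    using normal.inv_op_closed1[OF U g u] .
  have e: "u \<otimes> g = g \<otimes> (inv g \<otimes> u \<otimes> g)"
    using g uG by (simp add: m_assoc inv_mult_cancel)
  have "conj_set G u (conj_set G g A) = conj_set G (u \<otimes> g) A"
    by (rule conj_set_mult[OF uG g A(1)])
  also have "\<dots> = conj_set G g (conj_set G (inv g \<otimes> u \<otimes> g) A)"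
    using conj_set_mult[OF g _ A(1), of "inv g \<otimes> u \<otimes> g"] g uG e by simp
  also have "\<dots> \<subseteq> conj_set G g A"
    by (rule conj_set_mono) (use A(2) v in \<open>simp add: normalizes_iff_conj_set\<close>)
  finally show "conj_set G u (conj_set G g A) \<subseteq> conj_set G g A" .
qed

lemma normalizes_UN_conj_set:
  assumes M: "subgroup M G" and B: "B \<subseteq> carrier G"
  shows "normalizes G M (\<Union>m\<in>M. conj_set G m B)" (is "normalizes G M ?S")
  unfolding normalizes_iff_conj_set
proof
  fix k assume k: "k \<in> M"
  have "conj_set G k (conj_set G m B) \<subseteq> ?S" if m: "m \<in> M" for m
  proof -
    have "k \<in> carrier G" "m \<in> carrier G" using k m subgroup.subset[OF M] by blast+
    then have "conj_set G k (conj_set G m B) = conj_set G (k \<otimes> m) B"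
      using B by (rule conj_set_mult)
    then show ?thesis using subgroup.m_closed[OF M k m] by auto
  qed
  moreover have "conj_set G k ?S = (\<Union>m\<in>M. conj_set G k (conj_set G m B))"
    by (simp only: conj_set_def image_UN)
  ultimately show "conj_set G k ?S \<subseteq> ?S" by auto
qed

lemma normalizes_generate:
  assumes "S \<subseteq> carrier G" "U \<subseteq> carrier G" "normalizes G U S"
  shows "normalizes G U (generate G S)"
  unfolding normalizes_iff_conj_set
proof
  fix u assume u: "u \<in> U"
  then have uG: "u \<in> carrier G" using assms(2) by blast
  have "conj_set G u (generate G S) = generate G (conj_set G u S)"
    unfolding conj_set_def by (rule group_hom.generate_img[OF group_hom_conj[OF uG] assms(1), symmetric])
  also have "\<dots> \<subseteq> generate G S"
    by (rule mono_generate) (use assms(3) u in \<open>simp add: normalizes_iff_conj_set\<close>)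
  finally show "conj_set G u (generate G S) \<subseteq> generate G S" .
qed

lemma normalizes_lcs:
  assumes "Q \<subseteq> carrier G" "U \<subseteq> carrier G" "normalizes G U Q"
  shows "normalizes G U (lcs G Q i)"
  unfolding normalizes_iff_conj_set
proof
  fix u assume u: "u \<in> U"
  then have uG: "u \<in> carrier G" using assms(2) by blast
  have "conj_set G u (lcs G Q i) = lcs G (conj_set G u Q) i"
    unfolding conj_set_def by (rule group_hom.hom_lcs[OF group_hom_conj[OF uG] assms(1)])
  also have "\<dots> \<subseteq> lcs G Q i"
    by (rule lcs_mono) (use assms(3) u in \<open>simp add: normalizes_iff_conj_set\<close>)
  finally show "conj_set G u (lcs G Q i) \<subseteq> lcs G Q i" .
qed

section \<open>Centralizers and basal subgroups\<close>

lemma centralizer_in_carrier: "centralizer G S \<subseteq> carrier G"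
  by (auto simp: centralizer_def)

lemma centralizer_antimono: "R \<subseteq> S \<Longrightarrow> centralizer G S \<subseteq> centralizer G R"
  by (auto simp: centralizer_def)

lemma subset_centralizer_sym:
  assumes "R \<subseteq> carrier G" "S \<subseteq> centralizer G R"
  shows "R \<subseteq> centralizer G S"
  using assms by (auto simp: centralizer_def subset_iff)

lemma subgroup_centralizer:
  assumes "S \<subseteq> carrier G"
  shows "subgroup (centralizer G S) G"
proof (rule subgroupI)
  show "centralizer G S \<noteq> {}"
    using assms by (auto simp: centralizer_def subset_iff intro: exI[of _ \<one>])
  show "inv a \<in> centralizer G S" if "a \<in> centralizer G S" for a
  proof -
    have a: "a \<in> carrier G" using that by (simp add: centralizer_def)
    have "inv a \<otimes> s = s \<otimes> inv a" if s: "s \<in> S" for s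
    proof -
      have sG: "s \<in> carrier G" using s assms by blast
      have "a \<otimes> s = s \<otimes> a" using \<open>a \<in> centralizer G S\<close> s by (simp add: centralizer_def)
      then have "s = inv a \<otimes> (s \<otimes> a)"
        using a sG inv_mult_cancel(1)[OF a sG] by simp
      then show ?thesis
        using a sG by (metis inv_closed inv_solve_right m_assoc m_closed)
    qed
    then show ?thesis using a by (simp add: centralizer_def)
  qed
  show "a \<otimes> b \<in> centralizer G S" if "a \<in> centralizer G S" "b \<in> centralizer G S" for a b
  proof -
    have ab: "a \<in> carrier G" "b \<in> carrier G" using that by (simp_all add: centralizer_def)
    have "a \<otimes> b \<otimes> s = s \<otimes> (a \<otimes> b)" if s: "s \<in> S" for s
    proof -
      have sG: "s \<in> carrier G" using s assms by blast
      have "a \<otimes> s = s \<otimes> a" "b \<otimes> s = s \<otimes> b"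
        using \<open>a \<in> centralizer G S\<close> \<open>b \<in> centralizer G S\<close> s by (simp_all add: centralizer_def)
      then show ?thesis
        using ab sG by (metis m_assoc)
    qed
    then show ?thesis using ab by (simp add: centralizer_def)
  qed
qed (rule centralizer_in_carrier)

lemma centralizer_conj_set:
  assumes g: "g \<in> carrier G" and A: "A \<subseteq> centralizer G B" and B: "B \<subseteq> carrier G"
  shows "conj_set G g A \<subseteq> centralizer G (conj_set G g B)"
proof -
  interpret h: group_hom G G "\<lambda>x. g \<otimes> x \<otimes> inv g" by (rule group_hom_conj[OF g])
  have "g \<otimes> a \<otimes> inv g \<otimes> (g \<otimes> b \<otimes> inv g) = g \<otimes> b \<otimes> inv g \<otimes> (g \<otimes> a \<otimes> inv g)"
    if "a \<in> A" "b \<in> B" for a b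
  proof -
    have "a \<in> carrier G" "b \<in> carrier G" "a \<otimes> b = b \<otimes> a"
      using that A B by (auto simp: centralizer_def)
    then show ?thesis
      using h.hom_mult[of a b] h.hom_mult[of b a] by simp
  qed
  then show ?thesis
    using g A by (auto simp: centralizer_def conj_set_def subset_iff)
qed

lemma normalizes_centralizer:
  assumes "normalizes G (carrier G) S" "S \<subseteq> carrier G"
  shows "normalizes G (carrier G) (centralizer G S)"
  unfolding normalizes_iff_conj_set
proof
  fix g assume g: "g \<in> carrier G"
  have "conj_set G g S = S"
    by (rule conj_set_eq_self[OF subgroup_self g assms(2,1)])
  then show "conj_set G g (centralizer G S) \<subseteq> centralizer G S"
    using centralizer_conj_set[OF g order_refl assms(2)] by simp
qed

text \<open>The commutator of \<open>a\<close> and \<open>b\<close> lies in \<open>B\<close> when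
  bracketed one way and in \<open>A\<close> when bracketed the other way, so it is trivial.\<close>

lemma subset_centralizer_of_Int:
  assumes A: "subgroup A G" "normalizes G B A" and B: "subgroup B G" "normalizes G A B"
    and "A \<inter> B \<subseteq> {\<one>}"
  shows "A \<subseteq> centralizer G B"
proof
  fix a assume a: "a \<in> A"
  have aG: "a \<in> carrier G" using a subgroup.subset[OF A(1)] by blast
  have "a \<otimes> b = b \<otimes> a" if b: "b \<in> B" for b
  proof -
    have bG: "b \<in> carrier G" using b subgroup.subset[OF B(1)] by blast
    have "a \<otimes> b \<otimes> inv a \<otimes> inv b \<in> B"
      using normalizesD[OF B(2) a b] subgroup.m_closed[OF B(1)] subgroup.m_inv_closed[OF B(1) b] by simp
    moreover have "a \<otimes> (b \<otimes> inv a \<otimes> inv b) \<in> A"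
      using normalizesD[OF A(2) b subgroup.m_inv_closed[OF A(1) a]] subgroup.m_closed[OF A(1) a] by simp
    moreover have "a \<otimes> (b \<otimes> inv a \<otimes> inv b) = a \<otimes> b \<otimes> inv a \<otimes> inv b"
      using aG bG by (simp add: m_assoc)
    ultimately have "a \<otimes> b \<otimes> inv a \<otimes> inv b = \<one>" using assms(5) by auto
    then show ?thesis using commutator_one_iff[OF aG bG] by simp
  qed
  then show "a \<in> centralizer G B" using aG by (simp add: centralizer_def)
qed

text \<open>Take \<open>\<S>\<close> maximal among the families of conjugates of \<open>K\<close>
  that contain \<open>K\<close> and have non-trivial intersection. If \<open>B\<close> meets its
  conjugate by \<open>g\<close> non-trivially, maximality makes \<open>\<S>\<close> invariant under
  \<open>g\<close>, hence \<open>B\<close> too; otherwise the two normalize each other and commute.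
  The family is exported so that closedness of \<open>B\<close> can be deduced from that of
  \<open>K\<close>.\<close>

lemma basal_subgroup:
  assumes U: "U \<lhd> G" "finite_index G U"
    and K: "subgroup K G" "K \<subseteq> U" "normalizes G U K" "K \<noteq> {\<one>}"
  obtains B \<S> where "subgroup B G" "B \<subseteq> K" "normalizes G U B" "B \<noteq> {\<one>}"
    and "B = \<Inter>\<S>" "\<S> \<noteq> {}" "\<S> \<subseteq> (\<lambda>g. conj_set G g K) ` carrier G"
    and "\<And>g h. \<lbrakk>g \<in> carrier G; h \<in> carrier G\<rbrakk> \<Longrightarrow>
      conj_set G g B = conj_set G h B \<or> conj_set G g B \<subseteq> centralizer G (conj_set G h B)"
proof -
  define \<K> where "\<K> = (\<lambda>g. conj_set G g K) ` carrier G"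
  have Usub: "subgroup U G" using U(1) by (rule normal_imp_subgroup)
  have KG: "K \<subseteq> carrier G" using K(1) by (rule subgroup.subset)
  \<comment> \<open>\<open>U\<close> normalizes every conjugate of \<open>K\<close>, so a conjugate
    depends only on the coset of the conjugating element modulo \<open>U\<close>.\<close>
  have "finite \<K>"
    unfolding \<K>_def
  proof (rule finite_image_factor[OF finite_index_image_r_coset[OF U(2)]])
    fix g h assume gh: "g \<in> carrier G" "h \<in> carrier G" "U #> g = U #> h"
    have u: "g \<otimes> inv h \<in> U" by (rule r_coset_eqD[OF Usub gh])
    have "conj_set G g K = conj_set G (g \<otimes> inv h) (conj_set G h K)"
      using gh KG by (simp add: conj_set_mult m_assoc)
    also have "\<dots> = conj_set G h K"
      by (rule conj_set_eq_self[OF Usub u conj_set_in_carrier[OF gh(2) KG]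
            normalizes_conj_set[OF U(1) KG K(3) gh(2)]])
    finally show "conj_set G g K = conj_set G h K" .
  qed
  have \<K>: "subgroup A G \<and> normalizes G U A" if "A \<in> \<K>" for A
    using that subgroup_conj_set K(1) normalizes_conj_set[OF U(1) KG K(3)] by (auto simp: \<K>_def)
  have K\<K>: "K \<in> \<K>"
    unfolding \<K>_def by (rule image_eqI[of _ _ \<one>]) (simp_all add: conj_set_one KG)
  \<comment> \<open>Membership of \<open>K\<close> keeps the intersection inside \<open>K\<close>
    and the family non-empty.\<close>
  define \<F> where "\<F> = {\<S>. \<S> \<subseteq> \<K> \<and> K \<in> \<S> \<and> \<not> \<Inter>\<S> \<subseteq> {\<one>}}"
  have "finite \<F>"
    using \<open>finite \<K>\<close> by (auto simp: \<F>_def intro: finite_subset[of _ "Pow \<K>"])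
  moreover have "{K} \<in> \<F>"
    using K\<K> K(4) subgroup.one_closed[OF K(1)] by (auto simp: \<F>_def)
  ultimately have "\<exists>\<S>\<in>\<F>. {K} \<subseteq> \<S> \<and> (\<forall>\<R>\<in>\<F>. \<S> \<subseteq> \<R> \<longrightarrow> \<S> = \<R>)"
    by (rule finite_has_maximal2)
  then obtain \<S> where \<S>: "\<S> \<in> \<F>" and max: "\<And>\<R>. \<lbrakk>\<R> \<in> \<F>; \<S> \<subseteq> \<R>\<rbrakk> \<Longrightarrow> \<S> = \<R>"
    by auto
  define B where "B = \<Inter>\<S>"
  have \<S>K: "\<S> \<subseteq> \<K>" "K \<in> \<S>" "\<not> B \<subseteq> {\<one>}" using \<S> by (auto simp: \<F>_def B_def)
  have B: "subgroup B G"
    unfolding B_def by (rule subgroups_Inter) (use \<S>K(1,2) \<K> in auto)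
  have BK: "B \<subseteq> K" using \<S>K(2) by (auto simp: B_def)
  have BG: "B \<subseteq> carrier G" using BK KG by blast
  have NB: "normalizes G U B"
    unfolding normalizes_def B_def
  proof (intro ballI InterI)
    fix u a A assume "u \<in> U" "a \<in> \<Inter>\<S>" "A \<in> \<S>"
    then show "u \<otimes> a \<otimes> inv u \<in> A"
      using normalizesD[of U A u a] \<K>[of A] \<S>K(1) by blast
  qed
  have conj_B: "conj_set G g B = \<Inter>((\<lambda>A. conj_set G g A) ` \<S>)" if g: "g \<in> carrier G" for g
  proof -
    have AG: "A \<subseteq> carrier G" if "A \<in> \<S>" for A
      using that \<S>K(1) \<K> subgroup.subset by blast
    have "\<Inter>((\<lambda>A. conj_set G g A) ` \<S>) = (\<Inter>A\<in>\<S>. {x \<in> carrier G. inv g \<otimes> x \<otimes> g \<in> A})"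
      using conj_set_eq_vimage[OF g AG] by simp
    also have "\<dots> = {x \<in> carrier G. inv g \<otimes> x \<otimes> g \<in> B}"
      using \<S>K(2) by (auto simp: B_def)
    finally show ?thesis using conj_set_eq_vimage[OF g BG] by simp
  qed
  have step: "conj_set G g B = B \<or> B \<subseteq> centralizer G (conj_set G g B)" if g: "g \<in> carrier G" for g
  proof (cases "B \<inter> conj_set G g B \<subseteq> {\<one>}")
    case True
    have gB: "subgroup (conj_set G g B) G" using subgroup_conj_set[OF g B] .
    \<comment> \<open>Both subgroups lie in \<open>U\<close>, which normalizes each of them, so they
      normalize each other.\<close>
    have "conj_set G g B \<subseteq> U"
      using conj_set_mono[of B U g] BK K(2) conj_set_eq_self[OF subgroup_self g]
        subgroup.subset[OF Usub] U(1) unfolding normal_iff_normalizes by blast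
    then have "B \<subseteq> centralizer G (conj_set G g B)"
      using subset_centralizer_of_Int[OF B normalizes_mono[OF NB] gB
          normalizes_mono[OF normalizes_conj_set[OF U(1) BG NB g]] True] BK K(2) by blast
    then show ?thesis ..
  next
    case False
    \<comment> \<open>The enlarged family has intersection \<open>B \<inter> conj_set G g B\<close>,
      so it is again admissible and maximality forces equality.\<close>
    let ?\<R> = "\<S> \<union> (\<lambda>A. conj_set G g A) ` \<S>"
    have "conj_set G g A \<in> \<K>" if A: "A \<in> \<S>" for A
    proof -
      obtain h where h: "h \<in> carrier G" "A = conj_set G h K"
        using A \<S>K(1) by (auto simp: \<K>_def)
      then have "conj_set G g A = conj_set G (g \<otimes> h) K"
        using conj_set_mult[OF g h(1) KG] by simp
      then show ?thesis using g h(1) by (simp add: \<K>_def)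
    qed
    moreover have "\<Inter>?\<R> = B \<inter> conj_set G g B"
      using conj_B[OF g] by (simp add: B_def Inter_Un_distrib)
    ultimately have "?\<R> \<in> \<F>" using \<S>K(1,2) False by (auto simp: \<F>_def)
    then have "\<S> = ?\<R>" using max by blast
    then have sub: "(\<lambda>A. conj_set G g A) ` \<S> \<subseteq> \<S>" by blast
    \<comment> \<open>An injective map of the finite family \<open>\<S>\<close> into itself is onto,
      so conjugation by \<open>g\<close> permutes \<open>\<S>\<close> and fixes its
      intersection.\<close>
    have "inj_on (\<lambda>A. conj_set G g A) \<S>"
    proof (rule inj_on_inverseI)
      fix A assume "A \<in> \<S>"
      then have "A \<subseteq> carrier G" using \<S>K(1) \<K> subgroup.subset by blast
      then show "conj_set G (inv g) (conj_set G g A) = A" by (rule conj_set_cancel[OF g])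
    qed
    then have "(\<lambda>A. conj_set G g A) ` \<S> = \<S>"
      by (rule endo_inj_surj[OF finite_subset[OF \<S>K(1) \<open>finite \<K>\<close>] sub])
    then show ?thesis using conj_B[OF g] by (simp add: B_def)
  qed
  \<comment> \<open>The general case is \<open>step\<close> for \<open>inv g \<otimes> h\<close>,
    conjugated by \<open>g\<close>.\<close>
  have "conj_set G g B = conj_set G h B \<or> conj_set G g B \<subseteq> centralizer G (conj_set G h B)"
    if g: "g \<in> carrier G" and h: "h \<in> carrier G" for g h
  proof -
    have k: "inv g \<otimes> h \<in> carrier G" using g h by simp
    have e: "conj_set G g (conj_set G (inv g \<otimes> h) B) = conj_set G h B"
      using conj_set_mult[OF g k BG] inv_mult_cancel(2)[OF g h] by simp
    show ?thesis
      using step[OF k] centralizer_conj_set[OF g _ conj_set_in_carrier[OF k BG], of B] e by auto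
  qed
  then show thesis
    using that[of B \<S>] B BK NB \<S>K B_def by (auto simp: \<K>_def)
qed

end

section \<open>Closed subgroups, and maximal subgroups of finite index\<close>

context topological_group
begin

lemma closedin_conj_set:
  assumes "closedin T A" "g \<in> carrier G"
  shows "closedin T (conj_set G g A)"
proof -
  have "continuous_map T T (\<lambda>x. inv g \<otimes> x \<otimes> g)"
    using assms(2) by (intro continuous_map_group inv_closed)
  then have "closedin T {x \<in> carrier G. inv g \<otimes> x \<otimes> g \<in> A}"
    using assms(1) by (rule closedin_vimage)
  then show ?thesis
    by (simp add: conj_set_eq_vimage[OF assms(2) closedin_subset_carrier[OF assms(1)]])
qed

text \<open>The core is the intersection of the preimages of \<open>H\<close> under all
  conjugations.\<close>

lemma closedin_normal_core:
  assumes "closedin T H"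
  shows "closedin T (normal_core G H)"
proof -
  have "closedin T {x \<in> carrier G. g \<otimes> x \<otimes> inv g \<in> H}" if "g \<in> carrier G" for g
    using that by (intro closedin_vimage[OF _ assms] continuous_map_group inv_closed)
  then have "closedin T (\<Inter>g\<in>carrier G. {x \<in> carrier G. g \<otimes> x \<otimes> inv g \<in> H})"
    by (intro closedin_Inter) (use one_closed in auto)
  also have "(\<Inter>g\<in>carrier G. {x \<in> carrier G. g \<otimes> x \<otimes> inv g \<in> H}) = normal_core G H"
    using one_closed by (auto simp: normal_core_def)
  finally show ?thesis .
qed

lemma normalizes_closure:
  assumes "S \<subseteq> carrier G" "U \<subseteq> carrier G" "normalizes G U S"
  shows "normalizes G U (T closure_of S)"
  unfolding normalizes_def
proof (intro ballI)
  fix u a assume u: "u \<in> U" and a: "a \<in> T closure_of S"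
  show "u \<otimes> a \<otimes> inv u \<in> T closure_of S"
  proof (rule closure_of_unary[OF _ _ a])
    show "continuous_map T T (\<lambda>x. u \<otimes> x \<otimes> inv u)"
      using u assms(2) by (intro continuous_map_group inv_closed) auto
  qed (use assms(3) u in \<open>simp add: normalizes_def\<close>)
qed

lemma closedin_centralizer:
  assumes "closedin T {\<one>}" "S \<subseteq> carrier G"
  shows "closedin T (centralizer G S)"
proof -
  have "closedin T {x \<in> carrier G. x \<otimes> s = s \<otimes> x}" if "s \<in> S" for s
  proof -
    have s: "s \<in> carrier G" using that assms(2) by blast
    have "continuous_map T T (\<lambda>x. x \<otimes> s \<otimes> inv x \<otimes> inv s)"
      using s by (intro continuous_map_group inv_closed)
    then have "closedin T {x \<in> carrier G. x \<otimes> s \<otimes> inv x \<otimes> inv s \<in> {\<one>}}"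
      using assms(1) by (rule closedin_vimage)
    then show ?thesis
      using s commutator_one_iff by (simp cong: conj_cong)
  qed
  \<comment> \<open>The carrier is inserted to keep the family non-empty even when \<open>S\<close>
    is empty.\<close>
  then have "closedin T (\<Inter>(insert (carrier G) ((\<lambda>s. {x \<in> carrier G. x \<otimes> s = s \<otimes> x}) ` S)))"
    using closedin_topspace[of T] by (intro closedin_Inter) (auto simp: topspace_eq)
  also have "\<Inter>(insert (carrier G) ((\<lambda>s. {x \<in> carrier G. x \<otimes> s = s \<otimes> x}) ` S)) = centralizer G S"
    by (auto simp: centralizer_def)
  finally show ?thesis .
qed

text \<open>A centralizer is a closed subgroup, so it absorbs the closed subgroup generated by any
  subset of it.\<close>

lemma closure_generate_subset_centralizer:
  assumes "closedin T {\<one>}" "R \<subseteq> carrier G" "S \<subseteq> centralizer G R"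
  shows "T closure_of generate G S \<subseteq> centralizer G R"
  by (intro closure_of_minimal closedin_centralizer generate_subgroup_incl subgroup_centralizer assms)

lemma set_normalizer_subgroup:
  assumes "B \<subseteq> carrier G"
  shows "subgroup (set_normalizer G B) G"
proof (rule subgroupI)
  show "set_normalizer G B \<noteq> {}"
    using conj_set_one[OF assms] by (auto simp: set_normalizer_def)
  show "inv a \<in> set_normalizer G B" if "a \<in> set_normalizer G B" for a
    using that conj_set_cancel[OF _ assms, of a] by (auto simp: set_normalizer_def)
  show "a \<otimes> b \<in> set_normalizer G B" if "a \<in> set_normalizer G B" "b \<in> set_normalizer G B" for a b
    using that conj_set_mult[OF _ _ assms, of a b] by (auto simp: set_normalizer_def)
qed (auto simp: set_normalizer_def)

lemma closedin_set_normalizer: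
  assumes B: "closedin T B"
  shows "closedin T (set_normalizer G B)"
proof -
  have BG: "B \<subseteq> carrier G" using B by (rule closedin_subset_carrier)
  \<comment> \<open>Conjugation by \<open>x\<close> and by \<open>inv x\<close> must both keep
    \<open>B\<close> inside itself, since the normalizer asks for equality.\<close>
  have c: "closedin T {x \<in> carrier G. x \<otimes> b \<otimes> inv x \<in> B}"
    "closedin T {x \<in> carrier G. inv x \<otimes> b \<otimes> x \<in> B}" if "b \<in> B" for b
    using that BG by (auto intro!: closedin_vimage[OF _ B] continuous_map_group)
  let ?F = "insert (carrier G) ((\<lambda>b. {x \<in> carrier G. x \<otimes> b \<otimes> inv x \<in> B}) ` B \<union>
      (\<lambda>b. {x \<in> carrier G. inv x \<otimes> b \<otimes> x \<in> B}) ` B)"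
  have "closedin T (\<Inter>?F)"
    using closedin_topspace[of T] c by (intro closedin_Inter) (auto simp: topspace_eq)
  also have "\<Inter>?F = set_normalizer G B"
  proof -
    have "conj_set G g B = B \<longleftrightarrow> (\<forall>b\<in>B. g \<otimes> b \<otimes> inv g \<in> B) \<and> (\<forall>b\<in>B. inv g \<otimes> b \<otimes> g \<in> B)"
      if g: "g \<in> carrier G" for g
    proof -
      have "conj_set G g B \<subseteq> B \<longleftrightarrow> (\<forall>b\<in>B. g \<otimes> b \<otimes> inv g \<in> B)" by (auto simp: conj_set_def)
      moreover have "B \<subseteq> conj_set G g B \<longleftrightarrow> (\<forall>b\<in>B. inv g \<otimes> b \<otimes> g \<in> B)"
        using BG by (auto simp: conj_set_eq_vimage[OF g BG])
      ultimately show ?thesis by blast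
    qed
    then show ?thesis by (auto simp: set_normalizer_def)
  qed
  finally show ?thesis .
qed

text \<open>Every subgroup containing \<open>L\<close> is a union of right cosets of
  \<open>L\<close>, so there are only finitely many and a maximal proper closed one exists.\<close>

lemma maximal_subgroup_exists:
  assumes L: "closed_subgroup G T L" "finite_index G L" "L \<noteq> carrier G"
  obtains M where "maximal_subgroup G T M" "L \<subseteq> M"
proof -
  define \<F> where "\<F> = {K. closed_subgroup G T K \<and> L \<subseteq> K \<and> K \<noteq> carrier G}"
  have Lsub: "subgroup L G" using L(1) by (simp add: closed_subgroup_def)
  have "\<F> \<subseteq> \<Union> ` Pow (rcosets L)"
  proof
    fix K assume "K \<in> \<F>"
    then have K: "subgroup K G" "L \<subseteq> K" by (auto simp: \<F>_def closed_subgroup_def)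
    have KG: "K \<subseteq> carrier G" using K(1) by (rule subgroup.subset)
    have "L #> x \<subseteq> K" if "x \<in> K" for x
      using that K subgroup.m_closed[OF K(1)] by (auto simp: r_coset_def)
    moreover have "x \<in> L #> x" if "x \<in> K" for x
      using rcos_self[OF _ Lsub] that KG by blast
    ultimately have "K = \<Union>((\<lambda>x. L #> x) ` K)" by blast
    moreover have "(\<lambda>x. L #> x) ` K \<in> Pow (rcosets L)"
      using KG by (auto simp: RCOSETS_def)
    ultimately show "K \<in> \<Union> ` Pow (rcosets L)" by (rule image_eqI)
  qed
  then have "finite \<F>"
    by (rule finite_subset) (use L(2) in \<open>simp add: finite_index_def\<close>)
  moreover have "L \<in> \<F>" using L by (simp add: \<F>_def)
  ultimately have "\<exists>M\<in>\<F>. L \<subseteq> M \<and> (\<forall>K\<in>\<F>. M \<subseteq> K \<longrightarrow> M = K)"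
    by (rule finite_has_maximal2)
  then obtain M where M: "M \<in> \<F>" "\<And>K. \<lbrakk>K \<in> \<F>; M \<subseteq> K\<rbrakk> \<Longrightarrow> M = K"
    by auto
  have "maximal_subgroup G T M"
    unfolding maximal_subgroup_def
  proof (intro conjI allI impI)
    fix K assume "closed_subgroup G T K \<and> M \<subseteq> K"
    then show "K = M \<or> K = carrier G"
      using M(1) M(2)[of K] by (auto simp: \<F>_def)
  qed (use M(1) in \<open>auto simp: \<F>_def\<close>)
  then show thesis using that M(1) by (simp add: \<F>_def)
qed

end

section \<open>Just non-(virtually nilpotent) groups\<close>

text \<open>The hypotheses of the theorem, translated to subsets of \<open>G\<close>: quotients are
  expressed by \<open>virt_nilpotent_mod\<close> and commutativity by containment in the own
  centralizer. The assumption \<open>closed_one\<close> holds in the profinite and in the discrete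
  case alike.\<close>

locale jnn_group = topological_group +
  fixes c :: nat
  assumes closed_one: "closedin T {\<one>}"
    and not_virt_nilpotent: "\<not> virt_nilpotent_mod c G {\<one>}"
    and virt_nilpotent_quotient:
      "\<lbrakk>closed_normal G T N; N \<noteq> {\<one>}\<rbrakk> \<Longrightarrow> virt_nilpotent_mod c G N"
    and abelian_normal_trivial:
      "\<lbrakk>closed_normal G T N; N \<subseteq> centralizer G N\<rbrakk> \<Longrightarrow> N = {\<one>}"
begin

text \<open>A trivial subgroup of finite index would itself witness virtual nilpotency. This makes
  \<open>centralizer_trivial\<close> applicable to normal subgroups of finite index.\<close>

lemma finite_index_nontrivial:
  assumes "subgroup U G" "finite_index G U"
  shows "U \<noteq> {\<one>}"
proof
  assume "U = {\<one>}"
  then have "lcs G U c \<subseteq> {\<one>}" using lcs_subset[OF assms(1), of c] by simp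
  then have "virt_nilpotent_mod c G {\<one>}"
    unfolding virt_nilpotent_mod_def using assms by (intro exI[of _ U]) simp
  then show False using not_virt_nilpotent by simp
qed

text \<open>The closed subgroup generated by \<open>S\<close> is normal and abelian, hence
  trivial.\<close>

lemma commuting_normal_subset_trivial:
  assumes S: "S \<subseteq> carrier G" "normalizes G (carrier G) S" "S \<subseteq> centralizer G S"
  shows "S \<subseteq> {\<one>}"
proof -
  let ?N = "T closure_of generate G S"
  have gen: "generate G S \<subseteq> carrier G" using S(1) by (rule generate_incl)
  have "S \<subseteq> generate G S" by (auto intro: generate.incl)
  also have "\<dots> \<subseteq> ?N" by (rule subset_closure[OF gen])
  finally have SN: "S \<subseteq> ?N" .
  \<comment> \<open>The closure argument is applied twice, once for each side of the
    commutation.\<close>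
  have "?N \<subseteq> centralizer G S"
    by (rule closure_generate_subset_centralizer[OF closed_one S(1,3)])
  then have "S \<subseteq> centralizer G ?N"
    by (rule subset_centralizer_sym[OF S(1)])
  then have "?N \<subseteq> centralizer G ?N"
    by (rule closure_generate_subset_centralizer[OF closed_one closure_subset_carrier])
  moreover have "closed_normal G T ?N"
    unfolding closed_normal_def normal_iff_normalizes
    by (intro conjI subgroup_closure generate_is_subgroup normalizes_closure normalizes_generate
        closedin_closure_of gen S order_refl)
  ultimately have "?N = {\<one>}" by (intro abelian_normal_trivial)
  then show ?thesis using SN by simp
qed

lemma centralizer_trivial:
  assumes N: "N \<lhd> G" "N \<noteq> {\<one>}"
  shows "centralizer G N = {\<one>}"
proof (rule ccontr)
  assume C1: "centralizer G N \<noteq> {\<one>}"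
  let ?N = "T closure_of N" and ?C = "centralizer G N"
  have sub: "subgroup N G" and norm: "normalizes G (carrier G) N"
    using N(1) by (simp_all add: normal_iff_normalizes)
  have NG: "N \<subseteq> carrier G" using sub by (rule subgroup.subset)
  have NN: "N \<subseteq> ?N" using NG by (rule subset_closure)
  have cN: "closed_normal G T ?N"
    unfolding closed_normal_def normal_iff_normalizes
    by (intro conjI subgroup_closure normalizes_closure closedin_closure_of sub norm NG order_refl)
  have cC: "closed_normal G T ?C"
    unfolding closed_normal_def normal_iff_normalizes
    by (intro conjI subgroup_centralizer normalizes_centralizer closedin_centralizer closed_one NG norm)
  have "?N \<noteq> {\<one>}"
    using NN N(2) subgroup.one_closed[OF sub] by blast
  then obtain L where L: "subgroup L G" "finite_index G L" "lcs G L c \<subseteq> ?N"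
    using virt_nilpotent_quotient[OF cN] unfolding virt_nilpotent_mod_def by blast
  obtain L' where L': "subgroup L' G" "finite_index G L'" "lcs G L' c \<subseteq> ?C"
    using virt_nilpotent_quotient[OF cC C1] unfolding virt_nilpotent_mod_def by blast
  have "N \<subseteq> centralizer G ?C"
    by (rule subset_centralizer_sym[OF NG order_refl])
  then have "?N \<subseteq> centralizer G ?C"
    by (rule closure_of_minimal) (rule closedin_centralizer[OF closed_one centralizer_in_carrier])
  then have "?N \<inter> ?C \<subseteq> centralizer G (?N \<inter> ?C)"
    using centralizer_antimono[of "?N \<inter> ?C" ?C] by blast
  moreover have "normalizes G (carrier G) (?N \<inter> ?C)"
    using cN cC by (intro normalizes_Int) (auto simp: closed_normal_def normal_iff_normalizes)
  ultimately have "?N \<inter> ?C \<subseteq> {\<one>}"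
    using closure_subset_carrier by (intro commuting_normal_subset_trivial) auto
  \<comment> \<open>\<open>L \<inter> L'\<close> is nilpotent modulo both \<open>?N\<close> and
    \<open>?C\<close>; this plays the role of the embedding into the product of the two
    quotients.\<close>
  moreover have "lcs G (L \<inter> L') c \<subseteq> lcs G L c" "lcs G (L \<inter> L') c \<subseteq> lcs G L' c"
    by (rule lcs_mono, blast)+
  ultimately have "lcs G (L \<inter> L') c \<subseteq> {\<one>}"
    using L(3) L'(3) by blast
  then have "virt_nilpotent_mod c G {\<one>}"
    using subgroups_Inter_pair[OF L(1) L'(1)] finite_index_Int[OF L(1) L'(1) L(2) L'(2)]
    unfolding virt_nilpotent_mod_def by blast
  then show False using not_virt_nilpotent by blast
qed

text \<open>A basal subgroup \<open>B\<close> inside \<open>A\<close> is abelian, so all its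
  conjugates commute with one another. Their union is a normal set of commuting elements and is
  therefore trivial.\<close>

lemma abelian_normalized_trivial:
  assumes U: "U \<lhd> G" "finite_index G U"
    and A: "subgroup A G" "A \<subseteq> U" "normalizes G U A" "A \<subseteq> centralizer G A"
  shows "A = {\<one>}"
proof (rule ccontr)
  assume "A \<noteq> {\<one>}"
  then obtain B where B: "subgroup B G" "B \<subseteq> A" "B \<noteq> {\<one>}"
    and basal: "\<And>g h. \<lbrakk>g \<in> carrier G; h \<in> carrier G\<rbrakk> \<Longrightarrow>
      conj_set G g B = conj_set G h B \<or> conj_set G g B \<subseteq> centralizer G (conj_set G h B)"
    using basal_subgroup[OF U A(1-3)] by metis
  have BG: "B \<subseteq> carrier G" using B(1) by (rule subgroup.subset)
  let ?S = "\<Union>g\<in>carrier G. conj_set G g B"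
  have "B \<subseteq> centralizer G B"
    using B(2) A(4) centralizer_antimono[OF B(2)] by blast
  \<comment> \<open>If the two conjugates coincide, this is commutativity of \<open>B\<close>,
    conjugated; otherwise \<open>basal\<close> gives it directly.\<close>
  then have comm: "conj_set G g B \<subseteq> centralizer G (conj_set G h B)"
    if "g \<in> carrier G" "h \<in> carrier G" for g h
    using basal[OF that] centralizer_conj_set[OF that(2) _ BG] by metis
  have "?S \<subseteq> {\<one>}"
  proof (rule commuting_normal_subset_trivial)
    show "?S \<subseteq> carrier G" using conj_set_in_carrier[OF _ BG] by blast
    show "normalizes G (carrier G) ?S"
      using subgroup_self BG by (rule normalizes_UN_conj_set)
    show "?S \<subseteq> centralizer G ?S"
    proof
      fix x assume "x \<in> ?S"
      then obtain g where g: "g \<in> carrier G" "x \<in> conj_set G g B" by blast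
      then have x: "x \<in> centralizer G (conj_set G h B)" if "h \<in> carrier G" for h
        using comm[OF g(1) that] by blast
      have "x \<in> carrier G" using g conj_set_in_carrier[OF _ BG] by blast
      then show "x \<in> centralizer G ?S"
        using x by (auto simp: centralizer_def)
    qed
  qed
  moreover have "B \<subseteq> ?S" using conj_set_one[OF BG] by blast
  ultimately show False using B(3) subgroup.one_closed[OF B(1)] by blast
qed

text \<open>Descent along the series: when term \<open>n+1\<close> is trivial, term \<open>n\<close>
  is central in \<open>Q\<close>, hence abelian and normalized by \<open>U\<close>, hence trivial.
  At term 0 this is \<open>Q\<close> itself.\<close>

lemma nilpotent_normalized_trivial:
  assumes U: "U \<lhd> G" "finite_index G U"
    and Q: "subgroup Q G" "Q \<subseteq> U" "normalizes G U Q" "lcs G Q n \<subseteq> {\<one>}"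
  shows "Q = {\<one>}"
proof -
  have UG: "U \<subseteq> carrier G" using U(1) by (rule normal_imp_subgroup[THEN subgroup.subset])
  have QG: "Q \<subseteq> carrier G" using Q(1) by (rule subgroup.subset)
  show ?thesis
    using Q(4)
  proof (induction n)
    case 0
    then show ?case using subgroup.one_closed[OF Q(1)] by auto
  next
    case (Suc n)
    let ?A = "lcs G Q n"
    have AG: "?A \<subseteq> carrier G" using QG by (rule lcs_in_carrier)
    have AQ: "?A \<subseteq> Q" using Q(1) by (rule lcs_subset)
    have "?A \<subseteq> centralizer G Q"
    proof
      fix a assume a: "a \<in> ?A"
      have "a \<otimes> q = q \<otimes> a" if q: "q \<in> Q" for q
      proof -
        have "a \<otimes> q \<otimes> inv a \<otimes> inv q \<in> lcs G Q (Suc n)"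
          unfolding lcs.simps by (rule generate.incl) (use a q in blast)
        then have "a \<otimes> q \<otimes> inv a \<otimes> inv q = \<one>" using Suc.prems by blast
        moreover have "a \<in> carrier G" "q \<in> carrier G" using a q AG QG by blast+
        ultimately show ?thesis using commutator_one_iff by simp
      qed
      then show "a \<in> centralizer G Q" using a AG by (auto simp: centralizer_def)
    qed
    then have "?A \<subseteq> centralizer G ?A" using centralizer_antimono[OF AQ] by blast
    then have "?A = {\<one>}"
      using AQ Q(2) by (intro abelian_normalized_trivial[OF U] lcs_subgroup[OF Q(1)]
          normalizes_lcs[OF QG UG Q(3)]) auto
    then show ?case by (intro Suc.IH) simp
  qed
qed

text \<open>The assumption \<open>maximal\<close> is the quotient condition for maximal subgroups of
  finite index, read in \<open>G\<close>. If \<open>B\<close> were not normal, some conjugate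
  \<open>D\<close>, commuting with a \<open>P\<close> modulo which \<open>G\<close> is virtually
  nilpotent, would meet a normal subgroup of finite index trivially and so centralize it.\<close>

lemma basal_subgroup_normal:
  assumes U: "U \<lhd> G" "finite_index G U"
    and B: "subgroup B G" "closedin T B" "B \<subseteq> U" "normalizes G U B" "B \<noteq> {\<one>}"
    and basal: "\<And>g h. \<lbrakk>g \<in> carrier G; h \<in> carrier G\<rbrakk> \<Longrightarrow>
      conj_set G g B = conj_set G h B \<or> conj_set G g B \<subseteq> centralizer G (conj_set G h B)"
    and maximal: "\<And>M P. \<lbrakk>maximal_subgroup G T M; finite_index G M; subgroup P G; closedin T P;
      P \<subseteq> M; normalizes G M P; P \<noteq> {\<one>}\<rbrakk> \<Longrightarrow> virt_nilpotent_mod c G P"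
  shows "normalizes G (carrier G) B"
proof (rule ccontr)
  assume not_normal: "\<not> normalizes G (carrier G) B"
  have Usub: "subgroup U G" using U(1) by (rule normal_imp_subgroup)
  have UG: "U \<subseteq> carrier G" using Usub by (rule subgroup.subset)
  have BG: "B \<subseteq> carrier G" using B(1) by (rule subgroup.subset)
  let ?N = "set_normalizer G B"
  have N: "subgroup ?N G" using BG by (rule set_normalizer_subgroup)
  have UN: "U \<subseteq> ?N"
    using conj_set_eq_self[OF Usub _ BG B(4)] UG by (auto simp: set_normalizer_def)
  have finN: "finite_index G ?N"
    by (rule finite_index_mono[OF Usub N UN U(2)])
  have "?N \<noteq> carrier G"
    using not_normal by (auto simp: set_normalizer_def normalizes_iff_conj_set)
  then obtain M where M: "maximal_subgroup G T M" and NM: "?N \<subseteq> M"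
    using maximal_subgroup_exists[of ?N] N closedin_set_normalizer[OF B(2)] finN
    unfolding closed_subgroup_def by metis
  have Msub: "subgroup M G" and Mclosed: "closedin T M" and Mproper: "M \<noteq> carrier G"
    using M by (simp_all add: maximal_subgroup_def closed_subgroup_def)
  have MG: "M \<subseteq> carrier G" using Msub by (rule subgroup.subset)
  have BM: "B \<subseteq> M" using B(3) UN NM by blast
  define S where "S = (\<Union>m\<in>M. conj_set G m B)"
  have SM: "S \<subseteq> M"
  proof -
    have "conj_set G m B \<subseteq> M" if "m \<in> M" for m
      using conj_set_mono[OF BM, of m] conj_set_eq_self[OF Msub that MG]
        subgroup_normalizes_subset[OF Msub order_refl] by simp
    then show ?thesis by (auto simp: S_def)
  qed
  have SG: "S \<subseteq> carrier G" using SM MG by blast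
  have normS: "normalizes G M S"
    unfolding S_def using Msub BG by (rule normalizes_UN_conj_set)
  have BS: "B \<subseteq> S"
    using conj_set_one[OF BG] subgroup.one_closed[OF Msub] by (auto simp: S_def)
  define P where "P = T closure_of generate G S"
  have gen: "generate G S \<subseteq> carrier G" using SG by (rule generate_incl)
  have "S \<subseteq> generate G S" by (auto intro: generate.incl)
  also have "\<dots> \<subseteq> P" unfolding P_def by (rule subset_closure[OF gen])
  finally have SP: "S \<subseteq> P" .
  have "virt_nilpotent_mod c G P"
  proof (rule maximal[OF M])
    show "finite_index G M" by (rule finite_index_mono[OF N Msub NM finN])
    show "subgroup P G"
      unfolding P_def by (intro subgroup_closure generate_is_subgroup SG)
    show "P \<subseteq> M"
      unfolding P_def by (intro closure_of_minimal Mclosed generate_subgroup_incl SM Msub)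
    show "normalizes G M P"
      unfolding P_def by (intro normalizes_closure normalizes_generate gen SG MG normS)
    show "P \<noteq> {\<one>}"
      using B(5) BS SP subgroup.one_closed[OF B(1)] by blast
  qed (simp add: P_def)
  then obtain L where L: "subgroup L G" "finite_index G L" "lcs G L c \<subseteq> P"
    unfolding virt_nilpotent_mod_def by blast
  \<comment> \<open>\<open>L\<close> is shrunk to a subgroup normal in \<open>G\<close> and inside
    \<open>U\<close>, so that \<open>V\<close> has trivial centralizer and normalizes
    \<open>D\<close>.\<close>
  define V where "V = normal_core G (L \<inter> U)"
  have LU: "subgroup (L \<inter> U) G" using L(1) Usub by (rule subgroups_Inter_pair)
  have V: "V \<lhd> G" "finite_index G V" "V \<subseteq> L" "V \<subseteq> U"
    using normal_normal_core[OF LU] normal_core_subset[OF LU]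
      finite_index_normal_core[OF LU finite_index_Int[OF L(1) Usub L(2) U(2)]]
    by (auto simp: V_def)
  have Vsub: "subgroup V G" using V(1) by (rule normal_imp_subgroup)
  have VG: "V \<subseteq> carrier G" using Vsub by (rule subgroup.subset)
  obtain g where g: "g \<in> carrier G" "g \<notin> M" using MG Mproper by blast
  define D where "D = conj_set G g B"
  have D: "subgroup D G" unfolding D_def by (rule subgroup_conj_set[OF g(1) B(1)])
  have DG: "D \<subseteq> carrier G" using D by (rule subgroup.subset)
  have normUD: "normalizes G U D"
    unfolding D_def by (rule normalizes_conj_set[OF U(1) BG B(4) g(1)])
  have "D \<subseteq> centralizer G S"
  proof -
    have "D \<subseteq> centralizer G (conj_set G m B)" if m: "m \<in> M" for m
    proof -
      have mG: "m \<in> carrier G" using m MG by blast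
      \<comment> \<open>Equality would put \<open>inv m \<otimes> g\<close> into the normalizer of
        \<open>B\<close>, hence into \<open>M\<close>, and with it \<open>g\<close>.\<close>
      have "conj_set G g B \<noteq> conj_set G m B"
      proof
        assume "conj_set G g B = conj_set G m B"
        then have "conj_set G (inv m \<otimes> g) B = B"
          using conj_set_mult[of "inv m" g B] conj_set_cancel[OF mG BG] g(1) mG BG by simp
        then have "inv m \<otimes> g \<in> M"
          using NM g(1) mG by (auto simp: set_normalizer_def)
        then have "m \<otimes> (inv m \<otimes> g) \<in> M" by (rule subgroup.m_closed[OF Msub m])
        then show False using inv_mult_cancel(2)[OF mG g(1)] g(2) by simp
      qed
      then show ?thesis using basal[OF g(1) mG] by (simp add: D_def)
    qed
    then show ?thesis using DG by (auto simp: S_def centralizer_def)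
  qed
  then have "S \<subseteq> centralizer G D" by (rule subset_centralizer_sym[OF SG])
  then have PD: "P \<subseteq> centralizer G D"
    unfolding P_def by (rule closure_generate_subset_centralizer[OF closed_one DG])
  define Q where "Q = D \<inter> V"
  have Q: "subgroup Q G" unfolding Q_def using D Vsub by (rule subgroups_Inter_pair)
  have normUV: "normalizes G U V"
    using V(1) UG normalizes_mono by (auto simp: normal_iff_normalizes)
  \<comment> \<open>Term \<open>c\<close> of \<open>Q\<close> lies in \<open>P\<close>, because
    \<open>Q\<close> is inside \<open>L\<close>. As \<open>P\<close> centralizes \<open>D\<close>,
    this term is central in \<open>Q\<close>, so one further commutator vanishes; hence
    \<open>Suc c\<close> below.\<close>
  have "lcs G Q c \<subseteq> P \<inter> Q"
    using lcs_mono[of Q L c] L(3) V(3) lcs_subset[OF Q, of c] by (auto simp: Q_def)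
  then have lcsQ: "lcs G Q c \<subseteq> centralizer G Q"
    using PD centralizer_antimono[of Q D] by (auto simp: Q_def)
  have nilQ: "lcs G Q (Suc c) \<subseteq> {\<one>}"
    unfolding lcs.simps
  proof (rule generate_subgroup_incl[OF _ triv_subgroup])
    show "{a \<otimes> b \<otimes> inv a \<otimes> inv b | a b. a \<in> lcs G Q c \<and> b \<in> Q} \<subseteq> {\<one>}"
    proof clarify
      fix a b assume ab: "a \<in> lcs G Q c" "b \<in> Q"
      then have "a \<in> carrier G" "b \<in> carrier G" "a \<otimes> b = b \<otimes> a"
        using lcsQ subgroup.subset[OF Q] by (auto simp: centralizer_def)
      then show "a \<otimes> b \<otimes> inv a \<otimes> inv b = \<one>" using commutator_one_iff by blast
    qed
  qed
  have "Q \<subseteq> U" using V(4) by (auto simp: Q_def)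
  moreover have "normalizes G U Q"
    unfolding Q_def using normUD normUV by (rule normalizes_Int)
  ultimately have "Q = {\<one>}"
    using nilQ by (rule nilpotent_normalized_trivial[OF U Q])
  then have "D \<inter> V \<subseteq> {\<one>}" by (simp add: Q_def)
  moreover have "normalizes G D V"
    using V(1) DG normalizes_mono by (auto simp: normal_iff_normalizes)
  ultimately have "D \<subseteq> centralizer G V"
    using subset_centralizer_of_Int[OF D normalizes_mono[OF normUD V(4)] Vsub] by simp
  then have "D \<subseteq> {\<one>}"
    using centralizer_trivial[OF V(1) finite_index_nontrivial[OF Vsub V(2)]] by simp
  then have "conj_set G (inv g) D \<subseteq> {\<one>}"
    using g(1) by (auto simp: conj_set_def)
  then show False
    using conj_set_cancel[OF g(1) BG] B(5) subgroup.one_closed[OF B(1)] by (auto simp: D_def)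
qed

text \<open>A basal subgroup \<open>B\<close> of \<open>K \<inter> U\<close> is normal in
  \<open>G\<close>, so \<open>G\<close> is virtually nilpotent modulo \<open>B\<close>, and a
  fortiori modulo the larger \<open>K\<close>.\<close>

lemma virt_nilpotent_mod_of_maximal:
  assumes H: "subgroup H G" "closedin T H" "finite_index G H"
    and K: "subgroup K G" "closedin T K" "K \<subseteq> H" "normalizes G H K" "K \<noteq> {\<one>}"
    and maximal: "\<And>M P. \<lbrakk>maximal_subgroup G T M; finite_index G M; subgroup P G; closedin T P;
      P \<subseteq> M; normalizes G M P; P \<noteq> {\<one>}\<rbrakk> \<Longrightarrow> virt_nilpotent_mod c G P"
  shows "virt_nilpotent_mod c G K"
proof -
  define U where "U = normal_core G H"
  have U: "U \<lhd> G" "finite_index G U"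
    unfolding U_def using normal_normal_core[OF H(1)] finite_index_normal_core[OF H(1,3)] by auto
  have UH: "U \<subseteq> H" unfolding U_def using H(1) by (rule normal_core_subset)
  have Usub: "subgroup U G" using U(1) by (rule normal_imp_subgroup)
  have Uclosed: "closedin T U" unfolding U_def using H(2) by (rule closedin_normal_core)
  have KG: "K \<subseteq> carrier G" using K(1) by (rule subgroup.subset)
  have normKU: "normalizes G K U"
    using U(1) KG normalizes_mono by (auto simp: normal_iff_normalizes)
  have normUK: "normalizes G U K" using K(4) UH by (rule normalizes_mono)
  \<comment> \<open>If the intersection were trivial, \<open>K\<close> would centralize
    \<open>U\<close>, whose centralizer is trivial.\<close>
  have "K \<inter> U \<noteq> {\<one>}"
  proof
    assume "K \<inter> U = {\<one>}"
    then have "K \<subseteq> centralizer G U"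
      by (intro subset_centralizer_of_Int K(1) Usub normUK normKU) simp
    then have "K \<subseteq> {\<one>}"
      using centralizer_trivial[OF U(1) finite_index_nontrivial[OF Usub U(2)]] by simp
    then show False using K(5) subgroup.one_closed[OF K(1)] by blast
  qed
  moreover have "normalizes G U (K \<inter> U)"
    using normUK subgroup_normalizes_subset[OF Usub order_refl] by (rule normalizes_Int)
  moreover have "subgroup (K \<inter> U) G" using K(1) Usub by (rule subgroups_Inter_pair)
  ultimately obtain B \<S> where B: "subgroup B G" "B \<subseteq> K \<inter> U" "normalizes G U B" "B \<noteq> {\<one>}"
    and \<S>: "B = \<Inter>\<S>" "\<S> \<noteq> {}" "\<S> \<subseteq> (\<lambda>g. conj_set G g (K \<inter> U)) ` carrier G"
    and basal: "\<And>g h. \<lbrakk>g \<in> carrier G; h \<in> carrier G\<rbrakk> \<Longrightarrow>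
      conj_set G g B = conj_set G h B \<or> conj_set G g B \<subseteq> centralizer G (conj_set G h B)"
    using basal_subgroup[OF U, of "K \<inter> U"] by (metis inf_le2)
  \<comment> \<open>\<open>B\<close> is an intersection of conjugates of the closed set
    \<open>K \<inter> U\<close>, hence closed.\<close>
  have "closedin T A" if "A \<in> \<S>" for A
    using that \<S>(3) closedin_conj_set[OF closedin_Int[OF K(2) Uclosed]] by blast
  then have Bclosed: "closedin T B" unfolding \<S>(1) by (intro closedin_Inter \<S>(2))
  have "normalizes G (carrier G) B"
    using B by (intro basal_subgroup_normal[OF U _ Bclosed _ _ _ basal maximal]) auto
  then have "closed_normal G T B"
    using B(1) Bclosed by (simp add: closed_normal_def normal_iff_normalizes)
  then have "virt_nilpotent_mod c G B"
    using B(4) by (rule virt_nilpotent_quotient)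
  then show ?thesis
    using B(2) unfolding virt_nilpotent_mod_def by blast
qed

end

section \<open>Translation for subgroups of finite index, and the theorem\<close>

lemma (in group) normal_in_subgroup_iff:
  assumes H: "subgroup H G"
  shows "N \<lhd> (G\<lparr>carrier := H\<rparr>) \<longleftrightarrow> subgroup N G \<and> N \<subseteq> H \<and> normalizes G H N"
proof -
  have "subgroup N (G\<lparr>carrier := H\<rparr>) \<longleftrightarrow> subgroup N G \<and> N \<subseteq> H"
    using incl_subgroup[OF H] subgroup_incl[OF _ H] subgroup.subset[of N "G\<lparr>carrier := H\<rparr>"] by auto
  then show ?thesis
    using group.normal_inv_iff[OF subgroup.subgroup_is_group[OF H group_axioms], of N]
    by (auto simp: normalizes_def m_inv_consistent[OF H])
qed

text \<open>Closed subsets of the closed subgroup \<open>H\<close> are the closed subsets of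
  \<open>G\<close> inside \<open>H\<close>, and finite index lets virtual nilpotency be tested in
  \<open>G\<close>. In particular the first condition is the same for every
  \<open>H\<close>.\<close>

lemma (in topological_group) JNNF_subgroup_iff:
  assumes closed_one: "closedin T {\<one>}"
    and H: "subgroup H G" "closedin T H" "finite_index G H"
  shows "JNNF c (G\<lparr>carrier := H\<rparr>) (subtopology T H) \<longleftrightarrow> \<not> virt_nilpotent_mod c G {\<one>} \<and>
    (\<forall>N. subgroup N G \<and> closedin T N \<and> N \<subseteq> H \<and> normalizes G H N \<and> N \<noteq> {\<one>} \<longrightarrow>
      virt_nilpotent_mod c G N)"
proof -
  have one: "{\<one>} \<subseteq> H" using subgroup.one_closed[OF H(1)] by simp
  have closed: "closedin (subtopology T H) N \<longleftrightarrow> closedin T N \<and> N \<subseteq> H" for N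
    using closedin_closed_subtopology[OF H(2)] by simp
  have normal: "closed_normal (G\<lparr>carrier := H\<rparr>) (subtopology T H) N \<longleftrightarrow>
      subgroup N G \<and> closedin T N \<and> N \<subseteq> H \<and> normalizes G H N" for N
    unfolding closed_normal_def normal_in_subgroup_iff[OF H(1)] closed by blast
  have "closedin (subtopology T H) {\<one>}"
    using closed_one one closed by simp
  then have "JNNF c (G\<lparr>carrier := H\<rparr>) (subtopology T H) \<longleftrightarrow>
      \<not> virt_nilpotent_mod c (G\<lparr>carrier := H\<rparr>) {\<one>} \<and>
      (\<forall>N. closed_normal (G\<lparr>carrier := H\<rparr>) (subtopology T H) N \<and> N \<noteq> {\<one>} \<longrightarrow>
        virt_nilpotent_mod c (G\<lparr>carrier := H\<rparr>) N)"
    using topological_group.JNNF_iff[OF topological_group_subgroup[OF H(1)], of c] by simp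
  then show ?thesis
    unfolding normal
    using virt_nilpotent_mod_subgroup[OF H(1,3) one, of c] virt_nilpotent_mod_subgroup[OF H(1,3), of _ c]
    by auto
qed

lemma topological_group_of_profinite_or_discrete:
  assumes "profinite_group G T \<or> discrete_group G T"
  shows "topological_group G T" "closedin T {\<one>\<^bsub>G\<^esub>}"
proof -
  have "topological_group G T \<and> closedin T {\<one>\<^bsub>G\<^esub>}"
    using assms
  proof
    assume "profinite_group G T"
    then interpret profinite_group G T .
    show ?thesis
      using topological_group_axioms closedin_Hausdorff_singleton[OF Hausdorff, of "\<one>\<^bsub>G\<^esub>"]
      by (simp add: topspace_eq)
  next
    assume "discrete_group G T"
    then interpret discrete_group G T .
    \<comment> \<open>The product of discrete topologies is discrete, so both operations are
      continuous.\<close>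
    have "topological_group G T"
      by unfold_locales
        (auto simp: discrete simp flip: prod_topology_discrete_topology)
    then show ?thesis by (simp add: discrete)
  qed
  then show "topological_group G T" "closedin T {\<one>\<^bsub>G\<^esub>}" by auto
qed

theorem theorem3:
  fixes G :: "('a, 'b) monoid_scheme" and T :: "'a topology" and c :: nat
  assumes "profinite_group G T \<or> discrete_group G T"
    and "JNNF c G T"
    and "\<And>N. \<lbrakk>closed_normal G T N; comm_group (G\<lparr>carrier := N\<rparr>)\<rbrakk> \<Longrightarrow> N = {\<one>\<^bsub>G\<^esub>}"
  shows "hereditarily_JNNF c G T \<longleftrightarrow>
    (\<forall>M. maximal_subgroup G T M \<and> finite_index G M \<longrightarrow>
       JNNF c (G\<lparr>carrier := M\<rparr>) (subtopology T M))"
proof -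
  interpret topological_group G T
    using assms(1) by (rule topological_group_of_profinite_or_discrete)
  have closed_one: "closedin T {\<one>\<^bsub>G\<^esub>}"
    using assms(1) by (rule topological_group_of_profinite_or_discrete)
  have J: "\<not> virt_nilpotent_mod c G {\<one>\<^bsub>G\<^esub>}"
    "\<And>N. \<lbrakk>closed_normal G T N; N \<noteq> {\<one>\<^bsub>G\<^esub>}\<rbrakk> \<Longrightarrow> virt_nilpotent_mod c G N"
    using assms(2) JNNF_iff[OF closed_one, of c] by auto
  interpret jnn_group G T c
  proof
    fix N assume N: "closed_normal G T N" "N \<subseteq> centralizer G N"
    then have "subgroup N G" by (simp add: closed_normal_def normal_imp_subgroup)
    then have "comm_group (G\<lparr>carrier := N\<rparr>)"
      using N(2) by (intro group.group_comm_groupI subgroup.subgroup_is_group[OF _ is_group])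
        (auto simp: centralizer_def)
    then show "N = {\<one>\<^bsub>G\<^esub>}" by (rule assms(3)[OF N(1)])
  qed (fact closed_one J)+
  show ?thesis
  proof
    assume "hereditarily_JNNF c G T"
    then show "\<forall>M. maximal_subgroup G T M \<and> finite_index G M \<longrightarrow>
        JNNF c (G\<lparr>carrier := M\<rparr>) (subtopology T M)"
      by (simp add: hereditarily_JNNF_def maximal_subgroup_def)
  next
    assume max: "\<forall>M. maximal_subgroup G T M \<and> finite_index G M \<longrightarrow>
        JNNF c (G\<lparr>carrier := M\<rparr>) (subtopology T M)"
    \<comment> \<open>The condition on \<open>M\<close> is moved to \<open>G\<close>, the form in
      which \<open>virt_nilpotent_mod_of_maximal\<close> asks for it.\<close>
    have maximal: "virt_nilpotent_mod c G P"
      if M: "maximal_subgroup G T M" "finite_index G M"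
        and P: "subgroup P G" "closedin T P" "P \<subseteq> M" "normalizes G M P" "P \<noteq> {\<one>\<^bsub>G\<^esub>}" for M P
    proof -
      have "subgroup M G" "closedin T M"
        using M(1) by (simp_all add: maximal_subgroup_def closed_subgroup_def)
      moreover have "JNNF c (G\<lparr>carrier := M\<rparr>) (subtopology T M)" using max M by simp
      ultimately show ?thesis
        using JNNF_subgroup_iff[OF closed_one, of M c] M(2) P by simp
    qed
    show "hereditarily_JNNF c G T"
      unfolding hereditarily_JNNF_def
    proof (intro allI impI)
      fix H assume "closed_subgroup G T H \<and> finite_index G H"
      then have H: "subgroup H G" "closedin T H" "finite_index G H"
        by (simp_all add: closed_subgroup_def)
      \<comment> \<open>That \<open>H\<close> is not virtually nilpotent is inherited from
        \<open>G\<close> by finite index, so the work lies in the quotient condition.\<close>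
      show "JNNF c (G\<lparr>carrier := H\<rparr>) (subtopology T H)"
        unfolding JNNF_subgroup_iff[OF closed_one H]
        using J(1) virt_nilpotent_mod_of_maximal[OF H _ _ _ _ _ maximal] by simp
    qed
  qed
qed

end
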